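(* Let $G$ be a locally compact second countable group and let $\pi:(Y,\eta)\to(X,\nu)$ be a $G$-map of $G$-spaces. Let $\varphi:X\to S(G)$ be a $G$-equivariant measurable map such that $\mathrm{stab}(x)\subseteq\varphi(x)$ for $\nu$-almost every $x\in X$. Let $(Z,\zeta)$ be the quotient space of $(X,\nu)$ over $\varphi$ and let $(W,\rho)$ be the quotient space of $(Y,\eta)$ over $\varphi\circ\pi$. Let $\psi:(X,\nu)\to(Z,\zeta)$ and $\xi:(Y,\eta)\to(W,\rho)$ be the corresponding $G$-maps. Then there exists a $G$-map $\tau:(W,\rho)\to(Z,\zeta)$ such that $\tau\circ\xi=\psi\circ\pi$ (almost everywhere). Moreover, if $\pi$ is an orbital $G$-map and $\psi$ has the property that $\mathrm{stab}(\psi(x))=\varphi(x)$ almost everywhere, then $\tau$ is orbital (and, in particular, $\xi$ has the property that $\mathrm{stab}(\xi(y))=\varphi(\pi(y))$ almost everywhere).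
   Context: A $G$-space is a (standard) probability space $(X,\nu)$ with a measurable quasi-invariant action of $G$ (null sets are preserved). A $G$-map $\pi:(Y,\eta)\to(X,\nu)$ is a measurable map with $\pi_*\eta=\nu$ and $\pi(gy)=g\pi(y)$ for all $g$ and almost every $y$. $S(G)$ is the space of closed subgroups of $G$ with the Chabauty topology and conjugation action; $\mathrm{stab}(x)=\{g\in G:gx=x\}$. A $G$-map $\pi:(Y,\eta)\to(X,\nu)$ is orbital when $\mathrm{stab}(y)=\mathrm{stab}(\pi(y))$ for almost every $y\in Y$. Given a $G$-equivariant measurable $\varphi:X\to S(G)$ with $\mathrm{stab}(x)\subseteq\varphi(x)$ a.e., $f\in L^\infty(X,\nu)$ is $\varphi$-invariant when for almost every $x\in X$ and all $g\in\varphi(x)$, $f(gx)=f(x)$. The $\varphi$-invariant functions form a closed $G$-invariant subalgebra of $L^\infty(X,\nu)$, and the quotient space of $(X,\nu)$ over $\varphi$ is its Mackey point realization: a $G$-space $(Z,\zeta)$ with a $G$-map $\psi:(X,\nu)\to(Z,\zeta)$ such that the subalgebra equals $\{F\circ\psi:F\in L^\infty(Z,\zeta)\}$. *)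

theory Defs
  imports "HOL-Probability.Probability"
begin

text \<open>
  The group \<open>G\<close> is a type of class \<^class>\<open>topological_group_add\<close>, which is not assumed to be
  commutative: \<open>g + h\<close> is the group product, \<open>0\<close> the identity, \<open>- g\<close> the inverse, and
  \<open>g + h - g\<close> the conjugate of \<open>h\<close> by \<open>g\<close>.
\<close>

definition borel_of :: "'a topology \<Rightarrow> 'a measure" where
  "borel_of T = sigma (topspace T) {U. openin T U}"

definition standard_borel :: "'a measure \<Rightarrow> bool" where
  "standard_borel M \<longleftrightarrow>
     (\<exists>T. completely_metrizable_space T \<and> second_countable T \<and>
          space M = topspace T \<and> sets M = sets (borel_of T))"

definition standard_prob_space :: "'a measure \<Rightarrow> bool" where
  "standard_prob_space M \<longleftrightarrow> prob_space M \<and> standard_borel M"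

definition closed_subgroups :: "'g::topological_group_add set set" where
  "closed_subgroups =
     {H. closed H \<and> 0 \<in> H \<and> (\<forall>a\<in>H. \<forall>b\<in>H. a + b \<in> H) \<and> (\<forall>a\<in>H. - a \<in> H)}"

text \<open>The underlying set is \<open>closed_subgroups\<close>, since \<open>K = {}\<close> is allowed.\<close>

definition chabauty :: "'g::topological_group_add set topology" where
  "chabauty = topology_generated_by
     ({{H \<in> closed_subgroups. H \<inter> K = {}} | K. compact K} \<union>
      {{H \<in> closed_subgroups. H \<inter> U \<noteq> {}} | U. open U})"

definition conj_subgroup :: "'g::group_add \<Rightarrow> 'g set \<Rightarrow> 'g set" where
  "conj_subgroup g H = (\<lambda>h. g + h - g) ` H"

definition G_space :: "('g::topological_group_add \<Rightarrow> 'x \<Rightarrow> 'x) \<Rightarrow> 'x measure \<Rightarrow> bool" where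
  "G_space act M \<longleftrightarrow>
     standard_prob_space M \<and>
     (\<lambda>(g, x). act g x) \<in> borel \<Otimes>\<^sub>M M \<rightarrow>\<^sub>M M \<and>
     (\<forall>x\<in>space M. act 0 x = x) \<and>
     (\<forall>g h. \<forall>x\<in>space M. act (g + h) x = act g (act h x)) \<and>
     (\<forall>g. \<forall>A\<in>null_sets M. act g ` A \<in> null_sets M)"

definition stab :: "('g \<Rightarrow> 'x \<Rightarrow> 'x) \<Rightarrow> 'x \<Rightarrow> 'g set" where
  "stab act x = {g. act g x = x}"

definition G_map ::
  "('g \<Rightarrow> 'y \<Rightarrow> 'y) \<Rightarrow> 'y measure \<Rightarrow> ('g \<Rightarrow> 'x \<Rightarrow> 'x) \<Rightarrow> 'x measure \<Rightarrow> ('y \<Rightarrow> 'x) \<Rightarrow> bool" where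
  "G_map actY N actX M p \<longleftrightarrow>
     p \<in> N \<rightarrow>\<^sub>M M \<and> distr N M p = M \<and>
     (\<forall>g. AE y in N. p (actY g y) = actX g (p y))"

definition orbital_G_map ::
  "('g \<Rightarrow> 'y \<Rightarrow> 'y) \<Rightarrow> 'y measure \<Rightarrow> ('g \<Rightarrow> 'x \<Rightarrow> 'x) \<Rightarrow> 'x measure \<Rightarrow> ('y \<Rightarrow> 'x) \<Rightarrow> bool" where
  "orbital_G_map actY N actX M p \<longleftrightarrow>
     G_map actY N actX M p \<and> (AE y in N. stab actY y = stab actX (p y))"

text \<open>As for G-maps, equivariance is required for every \<open>g\<close> and almost every \<open>x\<close>;
  this includes the maps that are equivariant at every point.\<close>

definition equivariant_subgroup_map ::
  "('g::topological_group_add \<Rightarrow> 'x \<Rightarrow> 'x) \<Rightarrow> 'x measure \<Rightarrow> ('x \<Rightarrow> 'g set) \<Rightarrow> bool" where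
  "equivariant_subgroup_map act M \<phi> \<longleftrightarrow>
     \<phi> \<in> M \<rightarrow>\<^sub>M borel_of chabauty \<and>
     (\<forall>g. AE x in M. \<phi> (act g x) = conj_subgroup g (\<phi> x))"

definition Linf :: "'x measure \<Rightarrow> ('x \<Rightarrow> real) set" where
  "Linf M = {f \<in> borel_measurable M. \<exists>C. AE x in M. \<bar>f x\<bar> \<le> C}"

text \<open>
  Elements of \<open>L\<^sup>\<infinity>\<close> are classes of functions modulo null sets, whereas the pointwise condition
  \<open>f (g x) = f x\<close> for almost every \<open>x\<close> and all \<open>g \<in> \<phi> x\<close> depends on the representative. A class is
  \<open>\<phi>\<close>-invariant if one of its representatives satisfies the condition. Both sets below
  are closed under equality almost everywhere, so comparing them compares sets of classes.
\<close>

definition invariant_algebra ::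
  "('g \<Rightarrow> 'x \<Rightarrow> 'x) \<Rightarrow> 'x measure \<Rightarrow> ('x \<Rightarrow> 'g set) \<Rightarrow> ('x \<Rightarrow> real) set" where
  "invariant_algebra act M \<phi> =
     {f \<in> Linf M. \<exists>f'\<in>Linf M. (AE x in M. f' x = f x) \<and>
        (AE x in M. \<forall>g\<in>\<phi> x. f' (act g x) = f' x)}"

definition pullback_algebra ::
  "'x measure \<Rightarrow> 'z measure \<Rightarrow> ('x \<Rightarrow> 'z) \<Rightarrow> ('x \<Rightarrow> real) set" where
  "pullback_algebra M Z \<psi> = {f \<in> Linf M. \<exists>F\<in>Linf Z. AE x in M. f x = F (\<psi> x)}"

definition quotient_space_over ::
  "('g::topological_group_add \<Rightarrow> 'x \<Rightarrow> 'x) \<Rightarrow> 'x measure \<Rightarrow> ('x \<Rightarrow> 'g set) \<Rightarrow>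
   ('g \<Rightarrow> 'z \<Rightarrow> 'z) \<Rightarrow> 'z measure \<Rightarrow> ('x \<Rightarrow> 'z) \<Rightarrow> bool" where
  "quotient_space_over actX M \<phi> actZ Z \<psi> \<longleftrightarrow>
     G_space actZ Z \<and> G_map actX M actZ Z \<psi> \<and>
     invariant_algebra actX M \<phi> = pullback_algebra M Z \<psi>"

end

theory Submission
  imports Defs
begin

text \<open>
  The maps \<open>\<pi>\<close>, \<open>\<psi>\<close>, \<open>\<xi>\<close> are equivariant only for each fixed \<open>g\<close> and almost every point, while
  \<open>\<phi>\<close>-invariance and stabilizers speak of all \<open>g\<close> in a subgroup at once, and such a subgroup can be
  a Haar null set. The proof therefore never evaluates an almost everywhere identity at such
  a \<open>g\<close> itself. It evaluates it at \<open>k\<close> and \<open>k + g\<close> for a random \<open>k\<close>. Let \<open>m\<close> be a probability measure on \<open>G\<close>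
  in the class of right Haar measure. By Fubini, for almost every point an identity that
  holds for each \<open>k\<close> almost everywhere holds for \<open>m\<close>-almost every \<open>k\<close>; the null sets
  of \<open>m\<close> are invariant under right translation, so it then holds at \<open>k + g\<close> as well, for every \<open>g\<close>
  and almost every \<open>k\<close>.

  \<^item> Let \<open>f'\<close> be a representative of a class on \<open>X\<close> that is pointwise \<open>\<phi>\<close>-invariant. The function
    \<open>h y = (\<integral>k. f' (- k + \<pi> (k y)) \<partial>m)\<close>, with \<open>+\<close> for the action, is a representative of \<open>f' \<circ> \<pi>\<close> and
    satisfies \<open>h (g y) = f' (g \<pi> y)\<close> for almost every \<open>y\<close> and every \<open>g\<close>. So it is invariant under
    \<open>\<phi> (\<pi> y)\<close> (\<open>invariant_algebra_comp\<close>), and \<open>F \<circ> \<psi> \<circ> \<pi>\<close> factors through \<open>\<xi>\<close> for every \<open>F\<close> in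
    \<open>L\<^sup>\<infinity>(Z)\<close>. Applied to the distances to the points of a dense sequence of \<open>Z\<close>, this gives \<open>\<tau>\<close>
    (\<open>factor_map_of_Linf\<close>).

  \<^item> If \<open>stab (\<psi> x) = \<phi> x\<close>, then \<open>\<phi>\<close> is equivariant for almost every \<open>k\<close>, because stabilizers are.
    For \<open>g \<in> \<phi> (\<pi> y)\<close> the element \<open>k + g - k\<close> lies in \<open>\<phi> (\<pi> (k y))\<close>, so invariant functions agree
    at \<open>k y\<close> and at \<open>(k + g) y\<close>. As they separate the points of \<open>W\<close>, \<open>g\<close> fixes \<open>\<xi> y\<close>
    (\<open>quotient_space_over_subset_stab\<close>). Conversely an almost equivariant map only enlarges
    stabilizers (\<open>G_map_stab_subset\<close>), so
    \<open>\<phi> (\<pi> y) \<subseteq> stab (\<xi> y) \<subseteq> stab (\<tau> (\<xi> y)) = stab (\<psi> (\<pi> y)) = \<phi> (\<pi> y)\<close>.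

  \<^item> This holds for almost every \<open>y\<close>. To read it as a statement about almost every \<open>w\<close> the set of all
    \<open>w\<close> with \<open>stab (\<tau> w) \<subseteq> stab w\<close> must be measurable, although it is defined by a quantifier
    over the uncountable group. Averages over \<open>U + g\<close> of a bounded function along an orbit are
    continuous in \<open>g\<close> and detect the stabilizer (\<open>stabilizer_functions\<close>); local compactness
    then reduces the quantifier to a countable dense set (\<open>stab_subset_stab_measurable\<close>).

  Right Haar measure is constructed in the classical way: limits of normalized covering numbers
  by small translates form a content on the compact sets (\<open>right_invariant_content_exists\<close>), and
  a content induces a Radon measure by inner and outer approximation.
\<close>

section \<open>Coverings by right translates\<close>

definition right_translates :: "'g::group_add set \<Rightarrow> 'g set \<Rightarrow> 'g set" where
  "right_translates V F = (\<Union>g\<in>F. (\<lambda>v. v + g) ` V)"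

text \<open>
  The covering numbers that Haar used to compare the sizes of compact sets. The translates are
  on the right since right invariance is wanted.
\<close>

definition covering_number :: "'g::group_add set \<Rightarrow> 'g set \<Rightarrow> nat" where
  "covering_number V K = (LEAST n. \<exists>F. finite F \<and> card F = n \<and> K \<subseteq> right_translates V F)"

lemma right_translates_Un:
  "right_translates V (F \<union> F') = right_translates V F \<union> right_translates V F'"
  by (auto simp: right_translates_def)

lemma right_translate_right_translates:
  "(\<lambda>v. v + h) ` right_translates V F = right_translates V ((\<lambda>g. g + h) ` F)"
  by (auto simp: right_translates_def image_iff add.assoc[symmetric])

lemma right_translates_right_translates_subset:
  assumes "K0 \<subseteq> right_translates V E"
  shows "right_translates K0 F \<subseteq> right_translates V ((\<lambda>(e, f). e + f) ` (E \<times> F))"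
proof
  fix x assume "x \<in> right_translates K0 F"
  then obtain k f where kf: "k \<in> K0" "f \<in> F" "x = k + f"
    by (auto simp: right_translates_def)
  with assms obtain v e where "v \<in> V" "e \<in> E" "k = v + e"
    by (auto simp: right_translates_def)
  with kf have "x = v + (e + f)" "(e, f) \<in> E \<times> F" by (auto simp: add.assoc)
  with \<open>v \<in> V\<close> show "x \<in> right_translates V ((\<lambda>(e, f). e + f) ` (E \<times> F))"
    unfolding right_translates_def by force
qed

lemma open_right_translate:
  fixes V :: "'g::topological_group_add set"
  assumes "open V"
  shows "open ((\<lambda>v. v + g) ` V)"
proof -
  have "(\<lambda>v. v + g) ` V = (\<lambda>x. x - g) -` V"
    by (auto simp: image_iff intro!: bexI[of _ "_ - g"])
  moreover have "continuous_on UNIV (\<lambda>x. x - g)"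
    by (intro continuous_intros)
  ultimately show ?thesis
    using assms by (simp add: open_vimage)
qed

lemma compact_right_translate:
  fixes K :: "'g::topological_group_add set"
  assumes "compact K"
  shows "compact ((\<lambda>v. v + g) ` K)"
  by (rule compact_continuous_image[OF _ assms]) (intro continuous_intros)

lemma ex_finite_right_translates:
  fixes V :: "'g::topological_group_add set"
  assumes "compact K" "open V" "0 \<in> V"
  shows "\<exists>F. finite F \<and> K \<subseteq> right_translates V F"
proof -
  have "K \<subseteq> (\<Union>g\<in>K. (\<lambda>v. v + g) ` V)"
    using \<open>0 \<in> V\<close> by (force intro: image_eqI[of _ _ 0])
  from compactE_image[OF assms(1) open_right_translate[OF \<open>open V\<close>] this]
  show ?thesis
    unfolding right_translates_def by metis
qed

lemma covering_number_le:
  assumes "finite F" "K \<subseteq> right_translates V F"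
  shows "covering_number V K \<le> card F"
  unfolding covering_number_def using assms by (intro Least_le) auto

lemma covering_number_witness:
  fixes V :: "'g::topological_group_add set"
  assumes "compact K" "open V" "0 \<in> V"
  obtains F where "finite F" "card F = covering_number V K" "K \<subseteq> right_translates V F"
proof -
  obtain F where F: "finite F" "K \<subseteq> right_translates V F"
    using ex_finite_right_translates[OF assms] by auto
  have "\<exists>F'. finite F' \<and> card F' = covering_number V K \<and> K \<subseteq> right_translates V F'"
    unfolding covering_number_def
    by (rule LeastI[where k = "card F"]) (use F in auto)
  with that show ?thesis by auto
qed

lemma covering_number_mono:
  fixes V :: "'g::topological_group_add set"
  assumes "compact L" "open V" "0 \<in> V" "K \<subseteq> L"
  shows "covering_number V K \<le> covering_number V L"
proof -
  obtain F where F: "finite F" "card F = covering_number V L" "L \<subseteq> right_translates V F"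
    by (rule covering_number_witness[OF assms(1-3)])
  show ?thesis
    using covering_number_le[OF F(1), of K V] F assms(4) by auto
qed

lemma covering_number_Un_le:
  fixes V :: "'g::topological_group_add set"
  assumes "compact K" "compact L" "open V" "0 \<in> V"
  shows "covering_number V (K \<union> L) \<le> covering_number V K + covering_number V L"
proof -
  obtain F where F: "finite F" "card F = covering_number V K" "K \<subseteq> right_translates V F"
    by (rule covering_number_witness[OF assms(1,3,4)])
  obtain F' where F': "finite F'" "card F' = covering_number V L" "L \<subseteq> right_translates V F'"
    by (rule covering_number_witness[OF assms(2,3,4)])
  have "covering_number V (K \<union> L) \<le> card (F \<union> F')"
    using F F' by (intro covering_number_le) (auto simp: right_translates_Un)
  also have "\<dots> \<le> card F + card F'" by (rule card_Un_le)
  finally show ?thesis using F F' by simp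
qed

text \<open>
  When no translate of \<open>V\<close> meets both sets, a covering of the union splits into two disjoint
  families, one for each set. This is the source of additivity.
\<close>

lemma covering_number_Un_ge:
  fixes V :: "'g::topological_group_add set"
  assumes "compact K" "compact L" "open V" "0 \<in> V"
    and far: "\<And>g. (\<lambda>v. v + g) ` V \<inter> K = {} \<or> (\<lambda>v. v + g) ` V \<inter> L = {}"
  shows "covering_number V K + covering_number V L \<le> covering_number V (K \<union> L)"
proof -
  obtain F where F: "finite F" "card F = covering_number V (K \<union> L)"
      "K \<union> L \<subseteq> right_translates V F"
    by (rule covering_number_witness[OF compact_Un[OF assms(1,2)] assms(3,4)])
  define meets where "meets A = {g\<in>F. (\<lambda>v. v + g) ` V \<inter> A \<noteq> {}}" for A
  have sub: "A \<subseteq> right_translates V (meets A)" if A: "A \<subseteq> K \<union> L" for A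
  proof
    fix a assume "a \<in> A"
    with A F(3) have "a \<in> right_translates V F" by blast
    then obtain g where "g \<in> F" "a \<in> (\<lambda>v. v + g) ` V"
      unfolding right_translates_def by auto
    with \<open>a \<in> A\<close> show "a \<in> right_translates V (meets A)"
      unfolding right_translates_def meets_def by auto
  qed
  have fin: "finite (meets A)" for A using F(1) by (simp add: meets_def)
  have "covering_number V K + covering_number V L \<le> card (meets K) + card (meets L)"
    by (intro add_mono covering_number_le fin sub) auto
  also have "\<dots> = card (meets K \<union> meets L)"
    using far by (intro card_Un_disjoint[symmetric] fin) (auto simp: meets_def)
  also have "\<dots> \<le> card F"
    using F(1) by (intro card_mono) (auto simp: meets_def)
  finally show ?thesis using F by simp
qed

lemma covering_number_translate:
  fixes V :: "'g::topological_group_add set"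
  assumes "compact K" "open V" "0 \<in> V"
  shows "covering_number V ((\<lambda>v. v + h) ` K) = covering_number V K"
proof -
  have le: "covering_number V ((\<lambda>v. v + h) ` L) \<le> covering_number V L"
    if L: "compact L" for L :: "'g set" and h
  proof -
    obtain F where F: "finite F" "card F = covering_number V L" "L \<subseteq> right_translates V F"
      by (rule covering_number_witness[OF L assms(2,3)])
    have "covering_number V ((\<lambda>v. v + h) ` L) \<le> card ((\<lambda>g. g + h) ` F)"
      using F image_mono[OF F(3), of "\<lambda>v. v + h"]
      by (intro covering_number_le) (auto simp: right_translate_right_translates)
    also have "\<dots> = card F" by (intro card_image) (auto simp: inj_on_def)
    finally show ?thesis using F by simp
  qed
  have "(\<lambda>v. v + (- h)) ` ((\<lambda>v. v + h) ` K) = K"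
    by (auto simp: image_image add.assoc)
  with le[OF compact_right_translate[OF assms(1)], of "- h" h] le[OF assms(1), of h]
  show ?thesis by simp
qed

text \<open>
  Bounds the numbers of \<open>K\<close> relative to those of \<open>K0\<close>, with a constant that does not depend on \<open>V\<close>;
  this keeps the normalized covering numbers in a compact product.
\<close>

lemma covering_number_chain:
  fixes V :: "'g::topological_group_add set"
  assumes "compact K0" "open V" "0 \<in> V" "finite F" "K \<subseteq> right_translates K0 F"
  shows "covering_number V K \<le> covering_number V K0 * card F"
proof -
  obtain E where E: "finite E" "card E = covering_number V K0" "K0 \<subseteq> right_translates V E"
    by (rule covering_number_witness[OF assms(1-3)])
  have "covering_number V K \<le> card ((\<lambda>(e, f). e + f) ` (E \<times> F))"
    using E assms right_translates_right_translates_subset[OF E(3), of F]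
    by (intro covering_number_le) auto
  also have "\<dots> \<le> card (E \<times> F)" using E assms by (intro card_image_le) auto
  finally show ?thesis using E by (simp add: card_cartesian_product)
qed

lemma covering_number_pos:
  fixes V :: "'g::topological_group_add set"
  assumes "compact K" "open V" "0 \<in> V" "K \<noteq> {}"
  shows "0 < covering_number V K"
proof -
  obtain F where F: "finite F" "card F = covering_number V K" "K \<subseteq> right_translates V F"
    by (rule covering_number_witness[OF assms(1-3)])
  have "F \<noteq> {}" using F(3) assms(4) by (auto simp: right_translates_def)
  with F show ?thesis by (metis card_gt_0_iff)
qed

text \<open>
  If \<open>v + g \<in> K\<close> and \<open>w + g \<in> L\<close>, then \<open>v - w\<close> lies in the compact set of all differences
  \<open>k - l\<close>, which misses \<open>0\<close>; for small \<open>V\<close> this is impossible.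
\<close>

lemma small_translates_separate_compacts:
  fixes K :: "'g::{topological_group_add, t2_space, first_countable_topology} set"
  assumes V: "\<And>S. open S \<Longrightarrow> 0 \<in> S \<Longrightarrow> \<forall>\<^sub>F n in sequentially. V n \<subseteq> S"
    and KL: "compact K" "compact L" "K \<inter> L = {}"
  shows "\<forall>\<^sub>F n in sequentially. \<forall>g. (\<lambda>v. v + g) ` V n \<inter> K = {} \<or> (\<lambda>v. v + g) ` V n \<inter> L = {}"
proof -
  define D where "D = (\<lambda>(k, l). k - l) ` (K \<times> L)"
  have "compact D"
    unfolding D_def split_def using KL
    by (intro compact_continuous_image compact_Times continuous_intros)
  then have "open (- D)" by (simp add: compact_imp_closed open_Compl)
  have "0 \<notin> D" using KL(3) by (auto simp: D_def)
  have "((\<lambda>p. fst p - snd p) \<longlongrightarrow> 0 - 0) (nhds 0 \<times>\<^sub>F (nhds 0 :: 'g filter))"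
    by (intro tendsto_diff filterlim_fst filterlim_snd)
  then have "\<forall>\<^sub>F p in nhds 0 \<times>\<^sub>F (nhds 0 :: 'g filter). fst p - snd p \<in> - D"
    using \<open>open (- D)\<close> \<open>0 \<notin> D\<close> by (auto simp: tendsto_def)
  then obtain P Q where PQ: "eventually P (nhds (0::'g))" "eventually Q (nhds (0::'g))"
      "\<And>x y. P x \<Longrightarrow> Q y \<Longrightarrow> x - y \<in> - D"
    unfolding eventually_prod_filter by auto
  then have "eventually (\<lambda>x. P x \<and> Q x) (nhds 0)" by (auto intro: eventually_conj)
  then obtain S where S: "open S" "0 \<in> S" "\<And>x. x \<in> S \<Longrightarrow> P x \<and> Q x"
    unfolding eventually_nhds by auto
  show ?thesis
    using V[OF S(1,2)]
  proof eventually_elim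
    case (elim n)
    show ?case
    proof (intro allI, rule ccontr)
      fix g
      assume "\<not> ((\<lambda>v. v + g) ` V n \<inter> K = {} \<or> (\<lambda>v. v + g) ` V n \<inter> L = {})"
      then obtain v w where vw: "v \<in> V n" "w \<in> V n" "v + g \<in> K" "w + g \<in> L" by auto
      have "v - w = (v + g) - (w + g)" by (simp add: diff_add_eq_diff_diff_swap)
      with vw have "v - w \<in> D" unfolding D_def by force
      moreover have "v - w \<in> - D" using PQ(3) S(3) elim vw by blast
      ultimately show False by simp
    qed
  qed
qed

text \<open>
  By Tychonoff's theorem a sequence of functions with pointwise bounds has a cluster point. Passing
  to a filter keeps every property that holds eventually along the sequence, and limits
  along it respect sums and inequalities: it replaces a Banach limit.
\<close>

lemma bounded_functions_have_limit_filter: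
  fixes f :: "nat \<Rightarrow> 'i \<Rightarrow> real"
  assumes "\<And>n i. f n i \<in> {0..c i}"
  obtains F l where "F \<noteq> bot" "F \<le> filtermap f sequentially" "\<And>i. ((\<lambda>h. h i) \<longlongrightarrow> l i) F"
proof -
  have "compactin (product_topology (\<lambda>i. euclidean) UNIV) (Pi\<^sub>E UNIV (\<lambda>i. {0..c i}))"
    by (subst compactin_PiE) auto
  then have "compact (Pi\<^sub>E UNIV (\<lambda>i. {0..c i}))"
    by (simp add: euclidean_product_topology)
  moreover have "filtermap f sequentially \<noteq> bot" by (simp add: filtermap_bot_iff)
  moreover have "eventually (\<lambda>h. h \<in> Pi\<^sub>E UNIV (\<lambda>i. {0..c i})) (filtermap f sequentially)"
    using assms by (simp add: eventually_filtermap PiE_UNIV_domain Pi_iff)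
  ultimately obtain l where l: "inf (nhds l) (filtermap f sequentially) \<noteq> bot"
    unfolding compact_filter by meson
  show ?thesis
  proof (rule that[OF l])
    fix i
    have "((\<lambda>h::'i \<Rightarrow> real. h i) \<longlongrightarrow> l i) (nhds l)"
      by (rule continuous_on_tendsto_compose[OF continuous_on_product_coordinates[of i] filterlim_ident])
        auto
    then show "((\<lambda>h. h i) \<longlongrightarrow> l i) (inf (nhds l) (filtermap f sequentially))"
      by (rule tendsto_mono[rotated]) simp
  qed simp
qed

section \<open>A right invariant content on compact sets\<close>

lemma compact_neighbourhood_of_0:
  assumes "locally_compact_space (euclidean :: 'g::topological_group_add topology)"
  obtains U K :: "'g::topological_group_add set" where "open U" "compact K" "0 \<in> U" "U \<subseteq> K"
proof -
  have "\<exists>U K :: 'g set. open U \<and> compact K \<and> 0 \<in> U \<and> U \<subseteq> K"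
    using assms unfolding locally_compact_space_def by simp
  with that show ?thesis by blast
qed

definition compact_content :: "('g::topological_space set \<Rightarrow> real) \<Rightarrow> bool" where
  "compact_content l \<longleftrightarrow>
     (\<forall>K. compact K \<longrightarrow> 0 \<le> l K) \<and>
     (\<forall>K L. compact K \<longrightarrow> compact L \<longrightarrow> K \<subseteq> L \<longrightarrow> l K \<le> l L) \<and>
     (\<forall>K L. compact K \<longrightarrow> compact L \<longrightarrow> l (K \<union> L) \<le> l K + l L) \<and>
     (\<forall>K L. compact K \<longrightarrow> compact L \<longrightarrow> K \<inter> L = {} \<longrightarrow> l (K \<union> L) = l K + l L)"

text \<open>
  Covering numbers by a shrinking sequence of neighbourhoods, divided by those of a fixed compact
  neighbourhood \<open>K0\<close> of the identity, are exactly monotone, subadditive and right invariant, and they are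
  additive on a given disjoint pair from some index on. All of this survives in a limit.
\<close>

theorem right_invariant_content_exists:
  assumes lc: "locally_compact_space
    (euclidean :: 'g::{topological_group_add, t2_space, first_countable_topology} topology)"
  obtains l :: "'g::{topological_group_add, t2_space, first_countable_topology} set \<Rightarrow> real" and K0 where "compact_content l"
    "\<And>K h. compact K \<Longrightarrow> l ((\<lambda>v. v + h) ` K) = l K" "compact K0" "l K0 = 1"
proof -
  obtain U K0 :: "'g set" where K0: "open U" "compact K0" "0 \<in> U" "U \<subseteq> K0"
    by (rule compact_neighbourhood_of_0[OF lc])
  obtain V :: "nat \<Rightarrow> 'g set" where V: "\<And>n. open (V n)" "\<And>n. 0 \<in> V n"
      "\<And>S. open S \<Longrightarrow> 0 \<in> S \<Longrightarrow> \<forall>\<^sub>F n in sequentially. V n \<subseteq> S"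
    by (rule countable_basis_at_decseq[of 0]) blast
  have pos: "0 < covering_number (V n) K0" for n
    using K0 by (intro covering_number_pos V) auto
  \<comment> \<open>The default value keeps \<open>f n\<close> inside a product of compact intervals indexed by all sets.\<close>
  define f where "f n K = (if compact K
      then real (covering_number (V n) K) / real (covering_number (V n) K0) else 0)" for n K
  define c where "c K = (if compact K then real (covering_number U K) else 0)" for K
  have "f n K \<in> {0..c K}" for n K
  proof (cases "compact K")
    case True
    obtain F where F: "finite F" "card F = covering_number U K" "K \<subseteq> right_translates U F"
      by (rule covering_number_witness[OF True K0(1,3)])
    have "K \<subseteq> right_translates K0 F"
      using F(3) K0(4) unfolding right_translates_def by blast
    from covering_number_chain[OF K0(2) V(1,2) F(1) this, of n] F(2)
    have "real (covering_number (V n) K)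
        \<le> real (covering_number (V n) K0) * real (covering_number U K)"
      by (metis of_nat_le_iff of_nat_mult)
    then show ?thesis
      using True pos[of n] by (simp add: f_def c_def divide_le_eq mult.commute)
  qed (simp add: f_def c_def)
  from bounded_functions_have_limit_filter[of f c, OF this]
  obtain F l where F: "F \<noteq> bot" "F \<le> filtermap f sequentially"
      and l: "\<And>K. ((\<lambda>h. h K) \<longlongrightarrow> l K) F"
    by blast
  have ev: "eventually P F" if "\<forall>\<^sub>F n in sequentially. P (f n)" for P
    using that F(2) by (auto simp: eventually_filtermap le_filter_def)
  have le: "l K \<le> l L" if "\<And>n. f n K \<le> f n L" for K L
    by (rule tendsto_le[OF F(1) l l]) (rule ev, simp add: that)
  show ?thesis
  proof (rule that)
    show "compact_content l"
      unfolding compact_content_def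
    proof (intro conjI allI impI)
      fix K :: "'g set"
      show "0 \<le> l K" 
        by (rule tendsto_le[OF F(1) l tendsto_const]) (rule ev, simp add: f_def)
    next
      fix K L :: "'g set" assume "compact K" "compact L" "K \<subseteq> L"
      then show "l K \<le> l L"
        using pos by (intro le) (auto simp: f_def intro!: divide_right_mono covering_number_mono V)
    next
      fix K L :: "'g set" assume KL: "compact K" "compact L"
      have sub: "f n (K \<union> L) \<le> f n K + f n L" for n
        using covering_number_Un_le[OF KL V(1,2), of n] KL
        by (simp add: f_def compact_Un add_divide_distrib[symmetric] divide_right_mono)
      then show "l (K \<union> L) \<le> l K + l L"
        by (intro tendsto_le[OF F(1) tendsto_add[OF l l] l] ev) simp
      assume disj: "K \<inter> L = {}"
      have sep: "\<forall>\<^sub>F n in sequentially.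
          \<forall>g. (\<lambda>v. v + g) ` V n \<inter> K = {} \<or> (\<lambda>v. v + g) ` V n \<inter> L = {}"
        by (rule small_translates_separate_compacts[OF _ KL disj]) (rule V(3))
      have "\<forall>\<^sub>F n in sequentially. f n (K \<union> L) = f n K + f n L"
        using sep
      proof eventually_elim
        case (elim n)
        from covering_number_Un_ge[OF KL V(1,2), of n] elim
        have "f n K + f n L \<le> f n (K \<union> L)"
          using KL by (auto simp: f_def compact_Un add_divide_distrib[symmetric] intro!: divide_right_mono)
        with sub[of n] show ?case by simp
      qed
      then have "\<forall>\<^sub>F h in F. h (K \<union> L) = h K + h L" by (rule ev)
      from tendsto_cong[OF this] l have "((\<lambda>h. h K + h L) \<longlongrightarrow> l (K \<union> L)) F" by blast
      from tendsto_unique[OF F(1) this tendsto_add[OF l l]]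
      show "l (K \<union> L) = l K + l L" .
    qed
    show "l ((\<lambda>v. v + h) ` K) = l K" if "compact K" for K h
      by (intro antisym le)
        (simp_all add: f_def that compact_right_translate covering_number_translate V)
    show "compact K0" by fact
    have "f n K0 = 1" for n using pos[of n] K0 by (simp add: f_def)
    then have "\<forall>\<^sub>F h in F. h K0 = 1" by (intro ev) simp
    from tendsto_cong[OF this] l have "((\<lambda>h. 1) \<longlongrightarrow> l K0) F" by blast
    from tendsto_unique[OF F(1) this tendsto_const] show "l K0 = 1" .
  qed
qed

section \<open>The Radon measure of a content\<close>

lemma compact_contentD:
  assumes "compact_content l"
  shows "compact K \<Longrightarrow> 0 \<le> l K"
    and "compact K \<Longrightarrow> compact L \<Longrightarrow> K \<subseteq> L \<Longrightarrow> l K \<le> l L"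
    and "compact K \<Longrightarrow> compact L \<Longrightarrow> l (K \<union> L) \<le> l K + l L"
    and "compact K \<Longrightarrow> compact L \<Longrightarrow> K \<inter> L = {} \<Longrightarrow> l (K \<union> L) = l K + l L"
    and "l {} = 0"
proof -
  note c = assms[unfolded compact_content_def]
  show "compact K \<Longrightarrow> 0 \<le> l K"
    by (rule c[THEN conjunct1, rule_format])
  show "compact K \<Longrightarrow> compact L \<Longrightarrow> K \<subseteq> L \<Longrightarrow> l K \<le> l L"
    by (rule c[THEN conjunct2, THEN conjunct1, rule_format])
  show "compact K \<Longrightarrow> compact L \<Longrightarrow> l (K \<union> L) \<le> l K + l L"
    by (rule c[THEN conjunct2, THEN conjunct2, THEN conjunct1, rule_format])
  show "compact K \<Longrightarrow> compact L \<Longrightarrow> K \<inter> L = {} \<Longrightarrow> l (K \<union> L) = l K + l L"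
    by (rule c[THEN conjunct2, THEN conjunct2, THEN conjunct2, rule_format])
  show "l {} = 0"
    using c[THEN conjunct2, THEN conjunct2, THEN conjunct2, rule_format, of "{}" "{}"] by simp
qed

lemma compact_subset_Un_open_split:
  fixes K :: "'a::t2_space set"
  assumes "compact K" "open U" "open V" "K \<subseteq> U \<union> V"
  obtains K1 K2 where "compact K1" "compact K2" "K1 \<subseteq> U" "K2 \<subseteq> V" "K = K1 \<union> K2"
proof -
  have "Hausdorff_space (euclidean :: 'a topology)"
    unfolding Hausdorff_space_def disjnt_def
    by (simp del: separation_t2) (meson hausdorff)
  moreover have "compactin euclidean (K - U)" "compactin euclidean (K - V)"
    using assms by (simp_all add: compact_diff)
  moreover have "disjnt (K - U) (K - V)" using assms(4) by (auto simp: disjnt_def)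
  ultimately obtain A B where "openin euclidean A" "openin euclidean B"
      "K - U \<subseteq> A" "K - V \<subseteq> B" "disjnt A B"
    by (rule Hausdorff_space_compact_separation)
  then have AB: "open A" "open B" "K - U \<subseteq> A" "K - V \<subseteq> B" "A \<inter> B = {}"
    by (auto simp: disjnt_def)
  have "K - A \<subseteq> U" "K - B \<subseteq> V" "K = (K - A) \<union> (K - B)"
    using AB(3-5) by auto
  with that[of "K - A" "K - B"] AB(1,2) assms(1) show ?thesis
    by (simp add: compact_diff)
qed

definition inner_content :: "('a::topological_space set \<Rightarrow> real) \<Rightarrow> 'a set \<Rightarrow> ennreal" where
  "inner_content l U = (SUP K\<in>{K. compact K \<and> K \<subseteq> U}. ennreal (l K))"

definition outer_content :: "('a::topological_space set \<Rightarrow> real) \<Rightarrow> 'a set \<Rightarrow> ennreal" where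
  "outer_content l A = (INF U\<in>{U. open U \<and> A \<subseteq> U}. inner_content l U)"

lemma content_le_inner_content: "compact K \<Longrightarrow> K \<subseteq> U \<Longrightarrow> ennreal (l K) \<le> inner_content l U"
  unfolding inner_content_def by (rule SUP_upper) simp

lemma inner_content_mono: "U \<subseteq> V \<Longrightarrow> inner_content l U \<le> inner_content l V"
  unfolding inner_content_def by (rule SUP_subset_mono) auto

lemma outer_content_mono: "A \<subseteq> B \<Longrightarrow> outer_content l A \<le> outer_content l B"
  unfolding outer_content_def by (rule INF_superset_mono) auto

lemma outer_content_le: "open U \<Longrightarrow> A \<subseteq> U \<Longrightarrow> outer_content l A \<le> inner_content l U"
  unfolding outer_content_def by (rule INF_lower) simp

lemma outer_content_open: "open U \<Longrightarrow> outer_content l U = inner_content l U"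
  by (intro antisym outer_content_le)
    (auto simp: outer_content_def intro!: INF_greatest inner_content_mono)

lemma inner_content_empty:
  assumes "compact_content l" shows "inner_content l {} = 0"
  using compact_contentD(5)[OF assms] by (simp add: inner_content_def)

lemma inner_content_Un:
  fixes U V :: "'a::t2_space set"
  assumes l: "compact_content l" and "open U" "open V"
  shows "inner_content l (U \<union> V) \<le> inner_content l U + inner_content l V"
  unfolding inner_content_def[of l "U \<union> V"]
proof (rule SUP_least, clarify)
  fix K assume K: "compact K" "K \<subseteq> U \<union> V"
  obtain K1 K2 where "compact K1" "compact K2" "K1 \<subseteq> U" "K2 \<subseteq> V" "K = K1 \<union> K2"
    by (rule compact_subset_Un_open_split[OF K(1) assms(2,3) K(2)])
  then have "ennreal (l K) \<le> ennreal (l K1) + ennreal (l K2)"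
    using compact_contentD(1,3)[OF l] by (metis ennreal_leI ennreal_plus)
  also have "\<dots> \<le> inner_content l U + inner_content l V"
    by (intro add_mono content_le_inner_content) fact+
  finally show "ennreal (l K) \<le> inner_content l U + inner_content l V" .
qed

lemma inner_content_UN_finite:
  fixes U :: "nat \<Rightarrow> 'a::t2_space set"
  assumes l: "compact_content l" and "\<And>i. open (U i)"
  shows "inner_content l (\<Union>i<n. U i) \<le> (\<Sum>i<n. inner_content l (U i))"
proof (induction n)
  case 0 show ?case by (simp add: inner_content_empty[OF l])
next
  case (Suc n)
  have "inner_content l (\<Union>i<Suc n. U i) = inner_content l ((\<Union>i<n. U i) \<union> U n)"
    by (simp add: lessThan_Suc Un_commute)
  also have "\<dots> \<le> inner_content l (\<Union>i<n. U i) + inner_content l (U n)"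
    using assms by (intro inner_content_Un) auto
  also have "\<dots> \<le> (\<Sum>i<Suc n. inner_content l (U i))"
    using Suc by (simp add: add_mono)
  finally show ?case .
qed

lemma inner_content_UN:
  fixes U :: "nat \<Rightarrow> 'a::t2_space set"
  assumes l: "compact_content l" and U: "\<And>i. open (U i)"
  shows "inner_content l (\<Union>i. U i) \<le> (\<Sum>i. inner_content l (U i))"
  unfolding inner_content_def[of l "\<Union>i. U i"]
proof (rule SUP_least, clarify)
  fix K assume K: "compact K" "K \<subseteq> (\<Union>i. U i)"
  obtain I where I: "finite I" "K \<subseteq> (\<Union>i\<in>I. U i)"
    by (rule compactE_image[OF K(1) _ K(2)]) (use U in auto)
  obtain n where n: "I \<subseteq> {..<n}"
    using I(1) finite_nat_iff_bounded by auto
  have "ennreal (l K) \<le> inner_content l (\<Union>i<n. U i)"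
    using K I n by (intro content_le_inner_content) (auto, blast)
  also have "\<dots> \<le> (\<Sum>i<n. inner_content l (U i))"
    by (rule inner_content_UN_finite[OF l U])
  also have "\<dots> \<le> (\<Sum>i. inner_content l (U i))"
    by (rule sum_le_suminf) auto
  finally show "ennreal (l K) \<le> (\<Sum>i. inner_content l (U i))" .
qed

text \<open>
  Enlarge each \<open>A i\<close> to an open set, at the cost of \<open>e / 2 ^ (i + 1)\<close>.
\<close>

lemma outer_content_countably_subadditive:
  fixes A :: "nat \<Rightarrow> 'a::t2_space set"
  assumes l: "compact_content l"
  shows "outer_content l (\<Union>i. A i) \<le> (\<Sum>i. outer_content l (A i))"
proof (rule ennreal_le_epsilon)
  fix e :: real assume e: "0 < e" and fin: "(\<Sum>i. outer_content l (A i)) < \<top>"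
  have fini: "outer_content l (A i) < \<top>" for i
    using fin le_less_trans[OF sum_le_suminf[of "\<lambda>i. outer_content l (A i)" "{i}"]] by simp
  have "\<exists>U. open U \<and> A i \<subseteq> U \<and> inner_content l U \<le> outer_content l (A i) + ennreal (e * (1/2)^Suc i)"
    for i
  proof -
    have "outer_content l (A i) < outer_content l (A i) + ennreal (e * (1/2)^Suc i)"
      using fini[of i] e
      by (cases "outer_content l (A i)") (auto simp: ennreal_plus[symmetric] ennreal_less_iff simp del: ennreal_plus)
    then show ?thesis
      unfolding outer_content_def[of l "A i"] INF_less_iff using less_imp_le by blast
  qed
  then obtain U where U: "\<And>i. open (U i)" "\<And>i. A i \<subseteq> U i"
      "\<And>i. inner_content l (U i) \<le> outer_content l (A i) + ennreal (e * (1/2)^Suc i)"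
    by metis
  have "outer_content l (\<Union>i. A i) \<le> inner_content l (\<Union>i. U i)"
    using U by (intro outer_content_le) auto
  also have "\<dots> \<le> (\<Sum>i. inner_content l (U i))"
    by (rule inner_content_UN[OF l U(1)])
  also have "\<dots> \<le> (\<Sum>i. outer_content l (A i) + ennreal (e * (1/2)^Suc i))"
    by (intro suminf_le U) auto
  also have "\<dots> = (\<Sum>i. outer_content l (A i)) + (\<Sum>i. ennreal (e * (1/2)^Suc i))"
    by (intro suminf_add[symmetric]) auto
  also have "(\<Sum>i. ennreal (e * (1/2)^Suc i)) = ennreal e"
    using sums_mult[OF power_half_series, of e] e
    by (intro suminf_ennreal_eq) auto
  finally show "outer_content l (\<Union>i. A i) \<le> (\<Sum>i. outer_content l (A i)) + ennreal e" .
qed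

lemma outer_measure_space_outer_content:
  fixes l :: "'a::t2_space set \<Rightarrow> real"
  assumes l: "compact_content l"
  shows "outer_measure_space (Pow UNIV) (outer_content l)"
  unfolding outer_measure_space_def
proof (intro conjI)
  show "positive (Pow UNIV) (outer_content l)"
    using inner_content_empty[OF l] by (simp add: positive_def outer_content_open)
  show "increasing (Pow UNIV) (outer_content l)"
    by (simp add: increasing_def outer_content_mono)
  show "countably_subadditive (Pow UNIV) (outer_content l)"
    by (simp add: countably_subadditive_def outer_content_countably_subadditive[OF l])
qed

text \<open>
  First exhaust \<open>V \<inter> U\<close> by a compact \<open>K\<close>, then the open set \<open>V - K\<close>, which contains \<open>V - U\<close>, by a
  compact \<open>L\<close>: the sets \<open>K\<close> and \<open>L\<close> are disjoint and lie in \<open>V\<close>.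
\<close>

lemma inner_content_split:
  fixes U V :: "'a::t2_space set"
  assumes l: "compact_content l" and U: "open U" and V: "open V"
  shows "inner_content l (V \<inter> U) + outer_content l (V - U) \<le> inner_content l V"
proof -
  have "ennreal (l K) + outer_content l (V - U) \<le> inner_content l V"
    if K: "compact K" "K \<subseteq> V \<inter> U" for K
  proof -
    have "outer_content l (V - U) \<le> inner_content l (V - K)"
      using K V by (intro outer_content_le) (auto simp: open_Diff compact_imp_closed)
    then have "ennreal (l K) + outer_content l (V - U) \<le> ennreal (l K) + inner_content l (V - K)"
      by (intro add_left_mono)
    also have "\<dots> = (SUP L\<in>{L. compact L \<and> L \<subseteq> V - K}. ennreal (l K) + ennreal (l L))"
      unfolding inner_content_def by (rule ennreal_SUP_add_right) auto
    also have "\<dots> \<le> inner_content l V"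
    proof (rule SUP_least, clarify)
      fix L assume L: "compact L" "L \<subseteq> V - K"
      have "ennreal (l K) + ennreal (l L) = ennreal (l (K \<union> L))"
        using K L compact_contentD(1,4)[OF l] by (subst compact_contentD(4)[OF l]) auto
      also have "\<dots> \<le> inner_content l V"
        using K L by (intro content_le_inner_content) auto
      finally show "ennreal (l K) + ennreal (l L) \<le> inner_content l V" .
    qed
    finally show ?thesis .
  qed
  then have "(SUP K\<in>{K. compact K \<and> K \<subseteq> V \<inter> U}. ennreal (l K) + outer_content l (V - U))
      \<le> inner_content l V"
    by (intro SUP_least) auto
  then show ?thesis
    unfolding inner_content_def[of l "V \<inter> U"]
    by (subst (asm) ennreal_SUP_add_left) auto
qed

text \<open>
  Open sets satisfy Caratheodory's criterion, so the outer measure is a measure on the Borel sets.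
\<close>

lemma open_in_lambda_system:
  fixes U :: "'a::t2_space set"
  assumes l: "compact_content l" and U: "open U"
  shows "U \<in> lambda_system UNIV (Pow UNIV) (outer_content l)"
proof -
  have "outer_content l (A \<inter> U) + outer_content l (A - U) \<le> outer_content l A" for A
    unfolding outer_content_def[of l A]
  proof (rule INF_greatest, clarify)
    fix V assume V: "open V" "A \<subseteq> V"
    have "outer_content l (A \<inter> U) + outer_content l (A - U)
        \<le> outer_content l (V \<inter> U) + outer_content l (V - U)"
      using V by (intro add_mono outer_content_mono) auto
    also have "\<dots> \<le> inner_content l V"
      using inner_content_split[OF l U V(1)] U V by (simp add: outer_content_open open_Int)
    finally show "outer_content l (A \<inter> U) + outer_content l (A - U) \<le> inner_content l V" .
  qed
  moreover have "outer_content l A \<le> outer_content l (A \<inter> U) + outer_content l (A - U)" for A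
  proof -
    have sub: "subadditive (Pow UNIV) (outer_content l)"
      using outer_measure_space_outer_content[OF l]
      by (intro ring_of_sets.countably_subadditive_subadditive[OF ring_of_sets_Pow])
        (auto simp: outer_measure_space_def)
    show ?thesis
      using subadditiveD[OF sub, of "A \<inter> U" "A - U"] by (auto simp: Int_Diff_Un)
  qed
  ultimately show ?thesis
    unfolding algebra.lambda_system_eq[OF algebra_Pow] by (auto intro: antisym)
qed

definition content_measure :: "('a::topological_space set \<Rightarrow> real) \<Rightarrow> 'a measure" where
  "content_measure l = measure_of UNIV (sets borel) (outer_content l)"

lemma sets_content_measure [simp, measurable_cong]: "sets (content_measure l) = sets borel"
  by (simp add: content_measure_def sets.sets_measure_of_eq sets_measure_of_conv)
    (metis sets.sigma_sets_eq space_borel)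

lemma space_content_measure [simp]: "space (content_measure l) = UNIV"
  by (simp add: content_measure_def space_measure_of_conv)

lemma emeasure_content_measure:
  fixes l :: "'a::t2_space set \<Rightarrow> real"
  assumes l: "compact_content l" and A: "A \<in> sets borel"
  shows "emeasure (content_measure l) A = outer_content l A"
proof -
  define L where "L = lambda_system UNIV (Pow UNIV) (outer_content l)"
  have ms: "measure_space UNIV L (outer_content l)"
    unfolding L_def
    by (rule sigma_algebra.caratheodory_lemma[OF sigma_algebra_Pow
          outer_measure_space_outer_content[OF l]])
  then interpret L: sigma_algebra UNIV L by (simp add: measure_space_def)
  have sub: "sets (borel :: 'a measure) \<subseteq> L"
    unfolding sets_borel
    by (rule L.sigma_sets_subset)
      (use open_in_lambda_system[OF l] in \<open>unfold L_def, blast\<close>)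
  show ?thesis
  proof (rule emeasure_measure_of[OF content_measure_def])
    show "positive (sets (content_measure l)) (outer_content l)"
      using ms by (auto simp: measure_space_def positive_def)
    show "countably_additive (sets (content_measure l)) (outer_content l)"
      using ms sub by (auto simp: measure_space_def countably_additive_def subset_eq)
    show "A \<in> sets (content_measure l)" using A by simp
  qed auto
qed

section \<open>Right Haar measure\<close>

lemma outer_content_translate:
  fixes l :: "'g::{topological_group_add, t2_space} set \<Rightarrow> real"
  assumes "\<And>K h. compact K \<Longrightarrow> l ((\<lambda>v. v + h) ` K) = l K"
  shows "outer_content l ((\<lambda>v. v + h) ` A) = outer_content l A"
proof -
  have inner: "inner_content l U \<le> inner_content l ((\<lambda>v. v + h) ` U)" for U h
    unfolding inner_content_def[of l U]
  proof (rule SUP_least, clarify)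
    fix K assume "compact K" "K \<subseteq> U"
    then have "ennreal (l ((\<lambda>v. v + h) ` K)) \<le> inner_content l ((\<lambda>v. v + h) ` U)"
      by (intro content_le_inner_content compact_right_translate) auto
    then show "ennreal (l K) \<le> inner_content l ((\<lambda>v. v + h) ` U)"
      using assms \<open>compact K\<close> by simp
  qed
  have translate_back: "(\<lambda>v. v + (- h)) ` (\<lambda>v. v + h) ` A = A" for A and h :: 'g
    by (auto simp: image_image add.assoc)
  have le: "outer_content l A \<le> outer_content l ((\<lambda>v. v + h) ` A)" for A h
    unfolding outer_content_def[of l "(\<lambda>v. v + h) ` A"]
  proof (rule INF_greatest, clarify)
    fix U assume U: "open U" "(\<lambda>v. v + h) ` A \<subseteq> U"
    have "A \<subseteq> (\<lambda>v. v + (- h)) ` U"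
      using image_mono[OF U(2), of "\<lambda>v. v + (- h)"] by (simp only: translate_back)
    then have "outer_content l A \<le> inner_content l ((\<lambda>v. v + (- h)) ` U)"
      by (intro outer_content_le open_right_translate U)
    also have "\<dots> \<le> inner_content l U"
      using inner[of "(\<lambda>v. v + (- h)) ` U" h] translate_back[of "- h" U] by simp
    finally show "outer_content l A \<le> inner_content l U" .
  qed
  show ?thesis
    using le[of A h] le[of "(\<lambda>v. v + h) ` A" "- h"] by (simp only: translate_back antisym)
qed

text \<open>
  A right invariant Radon measure. Inner regularity on open sets is what makes translation continuous
  in measure.
\<close>

definition right_haar :: "'g::topological_group_add measure \<Rightarrow> bool" where
  "right_haar \<mu> \<longleftrightarrow>
     sets \<mu> = sets borel \<and> emeasure \<mu> UNIV \<noteq> 0 \<and>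
     (\<forall>K. compact K \<longrightarrow> emeasure \<mu> K \<noteq> \<infinity>) \<and>
     (\<forall>U. open U \<longrightarrow> emeasure \<mu> U = (SUP K\<in>{K. compact K \<and> K \<subseteq> U}. emeasure \<mu> K)) \<and>
     (\<forall>g. distr \<mu> \<mu> (\<lambda>k. k + g) = \<mu>)"

theorem right_haar_exists:
  assumes lc: "locally_compact_space
    (euclidean :: 'g::{topological_group_add, t2_space, second_countable_topology} topology)"
  shows "\<exists>\<mu> :: 'g measure. right_haar \<mu>"
proof -
  obtain l :: "'g set \<Rightarrow> real" and K0 where l: "compact_content l"
      and inv: "\<And>K h. compact K \<Longrightarrow> l ((\<lambda>v. v + h) ` K) = l K"
      and K0: "compact K0" "l K0 = 1"
    by (rule right_invariant_content_exists[OF lc]) blast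
  define \<mu> where "\<mu> = content_measure l"
  have sets[measurable_cong, simp]: "sets \<mu> = sets borel" and space[simp]: "space \<mu> = UNIV"
    by (simp_all add: \<mu>_def)
  note em = emeasure_content_measure[OF l, folded \<mu>_def]
  have le_compact: "ennreal (l K) \<le> emeasure \<mu> K" if "compact K" for K
  proof -
    have "ennreal (l K) \<le> outer_content l K"
      unfolding outer_content_def using that by (intro INF_greatest content_le_inner_content) auto
    with that show ?thesis by (simp add: em compact_imp_closed borel_closed)
  qed
  have nonzero: "emeasure \<mu> UNIV \<noteq> 0"
    using content_le_inner_content[OF K0(1), of UNIV l] K0(2)
    by (auto simp: em outer_content_open)
  have finite: "emeasure \<mu> K \<noteq> \<infinity>" if K: "compact K" for K
  proof -
    have "\<forall>x::'g. \<exists>U. open U \<and> x \<in> U \<and> (\<exists>L. compact L \<and> U \<subseteq> L)"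
      using lc unfolding locally_compact_space_def by simp blast
    then obtain U L where U: "\<And>x::'g. open (U x)" "\<And>x. x \<in> U x"
        "\<And>x. compact (L x)" "\<And>x. U x \<subseteq> L x"
      by metis
    obtain C where C: "finite C" "K \<subseteq> (\<Union>x\<in>C. U x)"
      by (rule compactE_image[OF K, of UNIV U]) (use U(1,2) in blast)+
    have cL: "compact (\<Union>x\<in>C. L x)" using C(1) U(3) by (intro compact_UN) auto
    have "emeasure \<mu> K \<le> emeasure \<mu> (\<Union>x\<in>C. U x)"
      using C U(1) by (intro emeasure_mono) auto
    also have "\<dots> = inner_content l (\<Union>x\<in>C. U x)"
      using U(1) open_UN[of C U] by (simp add: em outer_content_open)
    also have "\<dots> \<le> ennreal (l (\<Union>x\<in>C. L x))"
      unfolding inner_content_def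
    proof (rule SUP_least, clarify)
      fix K' assume "compact K'" "K' \<subseteq> (\<Union>x\<in>C. U x)"
      with U(4) have "K' \<subseteq> (\<Union>x\<in>C. L x)" by fastforce
      with \<open>compact K'\<close> cL show "ennreal (l K') \<le> ennreal (l (\<Union>x\<in>C. L x))"
        by (intro ennreal_leI compact_contentD(2)[OF l])
    qed
    finally show ?thesis by (auto simp: top_unique)
  qed
  have inner: "emeasure \<mu> U = (SUP K\<in>{K. compact K \<and> K \<subseteq> U}. emeasure \<mu> K)" if "open U" for U
  proof (rule antisym)
    have "emeasure \<mu> U = inner_content l U" using that by (simp add: em outer_content_open)
    also have "\<dots> \<le> (SUP K\<in>{K. compact K \<and> K \<subseteq> U}. emeasure \<mu> K)"
      unfolding inner_content_def by (rule SUP_mono) (use le_compact in auto)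
    finally show "emeasure \<mu> U \<le> (SUP K\<in>{K. compact K \<and> K \<subseteq> U}. emeasure \<mu> K)" .
    show "(SUP K\<in>{K. compact K \<and> K \<subseteq> U}. emeasure \<mu> K) \<le> emeasure \<mu> U"
      using that by (intro SUP_least emeasure_mono) auto
  qed
  have shift: "distr \<mu> \<mu> (\<lambda>k. k + g) = \<mu>" for g
  proof (rule measure_eqI)
    fix A assume "A \<in> sets (distr \<mu> \<mu> (\<lambda>k. k + g))"
    then have A: "A \<in> sets borel" by simp
    have "(\<lambda>k. k + g) \<in> borel_measurable borel"
      by (intro borel_measurable_continuous_onI continuous_intros)
    then have meas: "(\<lambda>k. k + g) \<in> \<mu> \<rightarrow>\<^sub>M \<mu>" by (simp cong: measurable_cong_sets)
    have eq: "(\<lambda>v. v + (- g)) ` A = (\<lambda>k. k + g) -` A"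
      by (force simp: image_iff add.assoc)
    have "(\<lambda>k. k + g) -` A \<in> sets borel"
      using measurable_sets[OF meas, of A] A by simp
    then have "emeasure \<mu> ((\<lambda>k. k + g) -` A) = emeasure \<mu> A"
      using A outer_content_translate[OF inv, of "- g" A] by (simp add: em eq[symmetric])
    then show "emeasure (distr \<mu> \<mu> (\<lambda>k. k + g)) A = emeasure \<mu> A"
      using A by (simp add: emeasure_distr[OF meas])
  qed simp
  have "right_haar \<mu>"
    unfolding right_haar_def using nonzero finite inner shift by (intro conjI allI impI) auto
  then show ?thesis ..
qed

locale right_haar_group =
  fixes \<mu> :: "'g::{topological_group_add, t2_space, second_countable_topology} measure"
  assumes lc: "locally_compact_space (euclidean :: 'g topology)"
    and right_haar: "right_haar \<mu>"
begin

lemma sets_haar [simp, measurable_cong]: "sets \<mu> = sets borel"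
  and space_haar [simp]: "space \<mu> = UNIV"
  and haar_nonzero: "emeasure \<mu> UNIV \<noteq> 0"
  and haar_compact: "compact K \<Longrightarrow> emeasure \<mu> K \<noteq> \<infinity>"
  and haar_inner: "open U \<Longrightarrow> emeasure \<mu> U = (SUP K\<in>{K. compact K \<and> K \<subseteq> U}. emeasure \<mu> K)"
  and haar_distr: "distr \<mu> \<mu> (\<lambda>k. k + g) = \<mu>"
proof -
  note rh = right_haar[unfolded right_haar_def]
  show "sets \<mu> = sets borel" by (rule rh[THEN conjunct1])
  then show "space \<mu> = UNIV" using sets_eq_imp_space_eq[of \<mu> borel] by simp
  note rh = rh[THEN conjunct2]
  show "emeasure \<mu> UNIV \<noteq> 0" by (rule rh[THEN conjunct1])
  note rh = rh[THEN conjunct2]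
  show "compact K \<Longrightarrow> emeasure \<mu> K \<noteq> \<infinity>" by (rule rh[THEN conjunct1, rule_format])
  note rh = rh[THEN conjunct2]
  show "open U \<Longrightarrow> emeasure \<mu> U = (SUP K\<in>{K. compact K \<and> K \<subseteq> U}. emeasure \<mu> K)"
    by (rule rh[THEN conjunct1, rule_format])
  show "distr \<mu> \<mu> (\<lambda>k. k + g) = \<mu>" by (rule rh[THEN conjunct2, rule_format])
qed

lemma shift_measurable [measurable]: "(\<lambda>k::'g. k + g) \<in> borel_measurable borel"
  by (intro borel_measurable_continuous_onI continuous_intros)

lemma shift_measurable_haar: "(\<lambda>k. k + g) \<in> \<mu> \<rightarrow>\<^sub>M \<mu>"
  by measurable

lemma haar_AE_shift: "(AE k in \<mu>. P k) \<Longrightarrow> (AE k in \<mu>. P (k + g))"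
  using AE_distrD[OF shift_measurable_haar[of g], of P] unfolding haar_distr .

lemma haar_integral_shift:
  fixes f :: "'g \<Rightarrow> real"
  assumes "f \<in> borel_measurable borel"
  shows "(\<integral>k. f (k + g) \<partial>\<mu>) = (\<integral>k. f k \<partial>\<mu>)"
  using integral_distr[OF shift_measurable_haar, of f g] assms by (simp add: haar_distr)

text \<open>
  Stability under intersection makes the basis a generating system on which finite measures
  are determined.
\<close>

lemma relatively_compact_basis:
  obtains B :: "'g set set" where "countable B" "topological_basis B"
    "\<And>U V. U \<in> B \<Longrightarrow> V \<in> B \<Longrightarrow> U \<inter> V \<in> B" "\<And>U. U \<in> B \<Longrightarrow> \<exists>K. compact K \<and> U \<subseteq> K"
proof -
  obtain B0 :: "'g set set" where B0: "countable B0" "topological_basis B0"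
    using ex_countable_basis by blast
  define B where "B = Inter ` {F. F \<subseteq> B0 \<and> finite F} \<inter> {U. \<exists>K. compact K \<and> U \<subseteq> K}"
  show ?thesis
  proof (rule that)
    show "countable B"
      unfolding B_def
      using countable_Collect_finite_subset[OF B0(1)] by (intro countable_Int1 countable_image) (simp add: conj_commute)
    show "topological_basis B"
    proof (rule topological_basisI)
      fix U assume "U \<in> B"
      then show "open U"
        using topological_basis_open[OF B0(2)] by (auto simp: B_def intro!: open_Inter)
    next
      fix O' :: "'g set" and x assume O': "open O'" "x \<in> O'"
      obtain W K where W: "open W" "compact K" "x \<in> W" "W \<subseteq> K"
        using lc unfolding locally_compact_space_def by simp blast
      obtain U where U: "U \<in> B0" "x \<in> U" "U \<subseteq> O' \<inter> W"
        using topological_basisE[OF B0(2), of "O' \<inter> W" x] O' W by (auto simp: open_Int)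
      have "U \<in> B"
        unfolding B_def using U W by (auto intro!: image_eqI[of _ _ "{U}"])
      with U show "\<exists>B'\<in>B. x \<in> B' \<and> B' \<subseteq> O'" by auto
    qed
    show "U \<inter> V \<in> B" if UV: "U \<in> B" "V \<in> B" for U V
    proof -
      obtain E F K where "E \<subseteq> B0" "finite E" "U = \<Inter>E" "F \<subseteq> B0" "finite F" "V = \<Inter>F"
          "compact K" "U \<subseteq> K"
        using UV unfolding B_def by auto
      then have "U \<inter> V = \<Inter>(E \<union> F)" "E \<union> F \<subseteq> B0" "finite (E \<union> F)" "U \<inter> V \<subseteq> K" by auto
      with \<open>compact K\<close> show ?thesis unfolding B_def by blast
    qed
    show "\<exists>K. compact K \<and> U \<subseteq> K" if "U \<in> B" for U
      using that by (auto simp: B_def)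
  qed
qed

lemma haar_relatively_compact_finite:
  assumes "compact K" "U \<subseteq> K" shows "emeasure \<mu> U < \<infinity>"
proof -
  have "emeasure \<mu> U \<le> emeasure \<mu> K"
    using assms by (intro emeasure_mono) (auto simp: compact_imp_closed borel_closed)
  also have "\<dots> < \<infinity>" using haar_compact[OF assms(1)] by (simp add: less_top)
  finally show ?thesis .
qed

sublocale sigma_finite_measure \<mu>
proof -
  obtain B :: "'g set set" where B: "countable B" "topological_basis B"
      "\<And>U. U \<in> B \<Longrightarrow> \<exists>K. compact K \<and> U \<subseteq> K"
    by (rule relatively_compact_basis) blast
  have "x \<in> \<Union>B" for x
    by (rule topological_basisE[OF B(2), of UNIV x]) auto
  then have "\<Union>B = UNIV" by blast
  moreover have "emeasure \<mu> U \<noteq> \<infinity>" if U: "U \<in> B" for U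
  proof -
    obtain K where "compact K" "U \<subseteq> K" using B(3)[OF U] by blast
    from haar_relatively_compact_finite[OF this] show ?thesis by simp
  qed
  ultimately show "sigma_finite_measure \<mu>"
    using B topological_basis_open[OF B(2)]
    by (intro sigma_finite_measure.intro exI[of _ B]) auto
qed

text \<open>
  Averages of functions over the group need a probability measure; almost everywhere statements
  mean the same for both measures.
\<close>

theorem equivalent_prob_measure:
  obtains m :: "'g measure" where "prob_space m" "sets m = sets borel"
    "\<And>P. (AE k in m. P k) \<longleftrightarrow> (AE k in \<mu>. P k)"
proof -
  obtain h where h: "h \<in> borel_measurable \<mu>" "integral\<^sup>N \<mu> h \<noteq> \<infinity>"
      "\<And>x. 0 < h x" "\<And>x. h x < \<infinity>"
    using Ex_finite_integrable_function by auto
  define c where "c = integral\<^sup>N \<mu> h"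
  have "c \<noteq> 0"
  proof
    assume "c = 0"
    then have "AE x in \<mu>. h x = 0" using h(1) by (simp add: c_def nn_integral_0_iff_AE)
    then have "AE x in \<mu>. False" by eventually_elim (use h(3) in \<open>auto simp: less_le\<close>)
    with haar_nonzero AE_iff_measurable[of UNIV \<mu> "\<lambda>_. False"] show False by simp
  qed
  have "c \<noteq> \<infinity>" using h(2) by (simp add: c_def)
  define m where "m = density \<mu> (\<lambda>x. h x / c)"
  have hc: "(\<lambda>x. h x / c) \<in> borel_measurable \<mu>" using h(1) by measurable
  have "h x / c > 0" for x
    using h(3)[of x] \<open>c \<noteq> \<infinity>\<close> by (simp add: ennreal_zero_less_divide less_top)
  then have AE_m: "(AE k in m. P k) \<longleftrightarrow> (AE k in \<mu>. P k)" for P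
    unfolding m_def by (simp add: AE_density[OF hc])
  have "emeasure m (space m) = (\<integral>\<^sup>+x. h x / c \<partial>\<mu>)"
    by (simp add: m_def emeasure_density[OF hc])
  also have "\<dots> = c / c"
    using h(1) by (simp add: nn_integral_divide c_def)
  also have "\<dots> = 1"
    using \<open>c \<noteq> 0\<close> \<open>c \<noteq> \<infinity>\<close> by (simp add: ennreal_divide_self less_top)
  finally have "prob_space m" by (rule prob_spaceI)
  moreover have "sets m = sets borel" by (simp add: m_def)
  ultimately show ?thesis using AE_m by (rule that)
qed

end

section \<open>Polish metrics and point realizations\<close>

text \<open>
  A complete metric for the Borel structure of \<open>M\<close> with a dense sequence \<open>z\<close>. The bound by \<open>1\<close> puts the
  distance functions into \<open>L\<^sup>\<infinity>\<close>.
\<close>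

definition polish_metric :: "'x measure \<Rightarrow> ('x \<Rightarrow> 'x \<Rightarrow> real) \<Rightarrow> (nat \<Rightarrow> 'x) \<Rightarrow> bool" where
  "polish_metric M d z \<longleftrightarrow>
     Metric_space (space M) d \<and> Metric_space.mcomplete (space M) d \<and>
     (\<forall>x y. d x y \<le> 1) \<and> range z \<subseteq> space M \<and>
     (\<forall>x\<in>space M. \<forall>e>0. \<exists>i. d x (z i) < e) \<and>
     sets M = sigma_sets (space M) {U. openin (Metric_space.mtopology (space M) d) U}"

lemma standard_borel_polish_metric:
  assumes "standard_borel M" "space M \<noteq> {}"
  obtains d z where "polish_metric M d z"
proof -
  obtain T where T: "completely_metrizable_space T" "second_countable T" "space M = topspace T"
      "sets M = sets (borel_of T)"
    using assms(1) unfolding standard_borel_def by auto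
  obtain S d0 where d0: "Metric_space S d0" "Metric_space.mcomplete S d0" "T = Metric_space.mtopology S d0"
    using T(1) unfolding completely_metrizable_space_def by auto
  interpret D0: Metric_space S d0 by fact
  have S: "S = space M" using T(3) d0(3) by simp
  define d where "d = D0.capped_dist 1"
  interpret D: Metric_space S d unfolding d_def by (rule D0.capped_dist)
  have top: "D.mtopology = T"
    unfolding d_def d0(3) by (rule D0.mtopology_capped_metric)
  have complete: "D.mcomplete"
    unfolding d_def using d0(2) D0.mcomplete_capped_metric by blast
  obtain B where B: "countable B" "\<And>V. V \<in> B \<Longrightarrow> openin T V"
      "\<And>U x. openin T U \<Longrightarrow> x \<in> U \<Longrightarrow> \<exists>V\<in>B. x \<in> V \<and> V \<subseteq> U"
    using T(2) unfolding second_countable_def by metis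
  define B' where "B' = B - {{}}"
  obtain x0 where "x0 \<in> space M" using assms(2) by auto
  then obtain V0 where "V0 \<in> B'"
    using B(3)[of "topspace T" x0] T(3) by (auto simp: B'_def)
  define z where "z i = (SOME x. x \<in> from_nat_into B' i)" for i
  have z: "z i \<in> from_nat_into B' i" for i
  proof -
    have "from_nat_into B' i \<in> B'" using \<open>V0 \<in> B'\<close> by (intro from_nat_into) auto
    then have "from_nat_into B' i \<noteq> {}" by (auto simp: B'_def)
    then show ?thesis unfolding z_def by (simp add: some_in_eq)
  qed
  have "polish_metric M d z"
    unfolding polish_metric_def
  proof (intro conjI allI ballI impI)
    show "Metric_space (space M) d" using D.Metric_space_axioms S by simp
    show "Metric_space.mcomplete (space M) d" using complete S by simp
    show "d x y \<le> 1" for x y by (simp add: d_def D0.capped_dist_def)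
    show "range z \<subseteq> space M"
    proof clarify
      fix i
      have "from_nat_into B' i \<in> B'" using \<open>V0 \<in> B'\<close> by (intro from_nat_into) auto
      then have "from_nat_into B' i \<in> B" by (simp add: B'_def)
      from openin_subset[OF B(2)[OF this]] z[of i] T(3) show "z i \<in> space M" by auto
    qed
    show "sets M = sigma_sets (space M) {U. openin (Metric_space.mtopology (space M) d) U}"
      using T(3,4) top S
      by (simp add: borel_of_def sets_measure_of_conv openin_subset subset_Pow_Union Collect_mono_iff)
        (auto dest: openin_subset)
    fix x and e :: real assume x: "x \<in> space M" and e: "0 < e"
    have "openin T (D.mball x e)" using top by (metis D.openin_mball)
    moreover have "x \<in> D.mball x e" unfolding D.in_mball using x e S by simp
    ultimately obtain V where V: "V \<in> B" "x \<in> V" "V \<subseteq> D.mball x e"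
      using B(3) by metis
    then have "V \<in> B'" by (auto simp: B'_def)
    then obtain i where "from_nat_into B' i = V"
      using from_nat_into_surj[of B' V] B(1) by (auto simp: B'_def)
    then have "z i \<in> D.mball x e" using z[of i] V(3) by blast
    then show "\<exists>i. d x (z i) < e" unfolding D.in_mball by blast
  qed
  then show ?thesis by (rule that)
qed

context
  fixes M :: "'x measure" and d z
  assumes pm: "polish_metric M d z"
begin

interpretation D: Metric_space "space M" d
  using pm by (simp add: polish_metric_def)

lemma polish_metric_nonneg: "0 \<le> d x y" and polish_metric_le_1: "d x y \<le> 1"
  using pm D.nonneg by (auto simp: polish_metric_def)

lemma polish_metric_dense: "x \<in> space M \<Longrightarrow> 0 < e \<Longrightarrow> \<exists>i. d x (z i) < e"
  and polish_metric_centre: "z i \<in> space M"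
  using pm by (auto simp: polish_metric_def)

lemma polish_metric_eqI:
  assumes "x \<in> space M" "y \<in> space M" "\<And>i. d x (z i) = d y (z i)"
  shows "x = y"
proof (rule ccontr)
  assume "x \<noteq> y"
  then have "0 < d x y / 2" using assms by (simp add: D.mdist_pos_eq)
  from polish_metric_dense[OF assms(1) this] obtain i where "d x (z i) < d x y / 2" by blast
  moreover have "d x y \<le> d x (z i) + d (z i) y"
    using assms polish_metric_centre by (intro D.triangle)
  ultimately show False using assms(3)[of i] by (simp add: D.commute)
qed

lemma polish_metric_measurable_iff:
  "f \<in> N \<rightarrow>\<^sub>M M \<longleftrightarrow>
     f \<in> space N \<rightarrow> space M \<and> (\<forall>i. (\<lambda>w. d (f w) (z i)) \<in> borel_measurable N)"
proof (intro iffI conjI allI)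
  have sets: "sets M = sigma_sets (space M) {U. openin D.mtopology U}"
    using pm by (simp add: polish_metric_def)
  assume f: "f \<in> N \<rightarrow>\<^sub>M M"
  show "f \<in> space N \<rightarrow> space M" using f by (auto dest: measurable_space)
  fix i
  show "(\<lambda>w. d (f w) (z i)) \<in> borel_measurable N"
  proof (rule borel_measurableI_less)
    fix r
    have "D.mball (z i) r \<in> sets M" unfolding sets by (rule sigma_sets.Basic) simp
    then have "f -` D.mball (z i) r \<inter> space N \<in> sets N" using f by (rule measurable_sets[rotated])
    also have "f -` D.mball (z i) r \<inter> space N = {w \<in> space N. d (f w) (z i) < r}"
      using measurable_space[OF f] polish_metric_centre by (auto simp: D.commute)
    finally show "{w \<in> space N. d (f w) (z i) < r} \<in> sets N" .
  qed
next
  have sets: "sets M = sigma_sets (space M) {U. openin D.mtopology U}"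
    using pm by (simp add: polish_metric_def)
  assume "f \<in> space N \<rightarrow> space M \<and> (\<forall>i. (\<lambda>w. d (f w) (z i)) \<in> borel_measurable N)"
  then have f: "f \<in> space N \<rightarrow> space M" and [measurable]: "\<And>i. (\<lambda>w. d (f w) (z i)) \<in> borel_measurable N"
    by auto
  show "f \<in> N \<rightarrow>\<^sub>M M"
  proof (rule measurable_sigma_sets[OF sets])
    show "{U. openin D.mtopology U} \<subseteq> Pow (space M)" 
      using openin_subset[of D.mtopology] unfolding D.topspace_mtopology by auto
    show "f \<in> space N \<rightarrow> space M" by fact
    fix U assume "U \<in> {U. openin D.mtopology U}"
    then have U: "openin D.mtopology U" by simp
    define I where "I = {(i, n). D.mball (z i) (1 / real (Suc n)) \<subseteq> U}"
    have "f -` U \<inter> space N = {w\<in>space N. \<exists>i n. (i, n) \<in> I \<and> d (f w) (z i) < 1 / real (Suc n)}"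
    proof (intro set_eqI iffI)
      fix w assume w: "w \<in> f -` U \<inter> space N"
      then have "f w \<in> U" "f w \<in> space M" using f by auto
      then obtain r where r: "0 < r" "D.mball (f w) r \<subseteq> U"
        using U by (auto simp: D.openin_mtopology)
      obtain n where n: "1 / real (Suc n) < r / 2"
        using r(1) nat_approx_posE[of "r / 2"] by auto
      obtain i where i: "d (f w) (z i) < 1 / real (Suc n)"
        using polish_metric_dense[OF \<open>f w \<in> space M\<close>, of "1 / real (Suc n)"] by auto
      have "D.mball (z i) (1 / real (Suc n)) \<subseteq> D.mball (f w) r"
      proof
        fix y assume y: "y \<in> D.mball (z i) (1 / real (Suc n))"
        then have "d (f w) y \<le> d (f w) (z i) + d (z i) y"
          using \<open>f w \<in> space M\<close> by (intro D.triangle) auto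
        with y i n \<open>f w \<in> space M\<close> show "y \<in> D.mball (f w) r" by auto
      qed
      with r i w show "w \<in> {w\<in>space N. \<exists>i n. (i, n) \<in> I \<and> d (f w) (z i) < 1 / real (Suc n)}"
        by (auto simp: I_def)
    next
      fix w assume "w \<in> {w\<in>space N. \<exists>i n. (i, n) \<in> I \<and> d (f w) (z i) < 1 / real (Suc n)}"
      then obtain i n where *: "w \<in> space N" "D.mball (z i) (1 / real (Suc n)) \<subseteq> U"
          "d (f w) (z i) < 1 / real (Suc n)"
        by (auto simp: I_def)
      then have "f w \<in> D.mball (z i) (1 / real (Suc n))"
        using f polish_metric_centre by (auto simp: D.commute)
      with * show "w \<in> f -` U \<inter> space N" by auto
    qed
    also have "\<dots> \<in> sets N" by measurable
    finally show "f -` U \<inter> space N \<in> sets N" .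
  qed
qed

lemma polish_metric_borel_measurable: "(\<lambda>x. d x (z i)) \<in> borel_measurable M"
  using polish_metric_measurable_iff[of "\<lambda>x. x" M] by auto

lemma polish_metric_Linf: "(\<lambda>x. d x (z i)) \<in> Linf M"
  unfolding Linf_def using polish_metric_borel_measurable polish_metric_nonneg polish_metric_le_1
  by (auto intro!: exI[of _ 1])

lemma polish_metric_equality_set:
  assumes f: "f \<in> N \<rightarrow>\<^sub>M M" and g: "g \<in> N \<rightarrow>\<^sub>M M"
  shows "{x\<in>space N. f x = g x} \<in> sets N"
proof -
  have [measurable]: "(\<lambda>w. d (f w) (z i)) \<in> borel_measurable N"
      "(\<lambda>w. d (g w) (z i)) \<in> borel_measurable N" for i
    using f g unfolding polish_metric_measurable_iff by auto
  have "{x\<in>space N. f x = g x} = {x\<in>space N. \<forall>i. d (f x) (z i) = d (g x) (z i)}"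
    using measurable_space[OF f] measurable_space[OF g] polish_metric_eqI by auto
  also have "\<dots> \<in> sets N" by measurable
  finally show ?thesis .
qed

text \<open>
  A sequence of numbers is the sequence of distances from some point to the \<open>z i\<close> iff it satisfies
  the triangle inequalities (it is a Katetov function) and takes arbitrarily small values: points of the
  dense sequence with small value then form a Cauchy sequence. The right hand side has countably many
  conditions, so it is measurable in the numbers.
\<close>

lemma polish_metric_point_of_distances:
  fixes D :: "nat \<Rightarrow> real"
  shows "(\<exists>x\<in>space M. \<forall>i. d x (z i) = D i) \<longleftrightarrow>
     (\<forall>n. \<exists>i. D i < 1 / real (Suc n)) \<and>
     (\<forall>i j. \<bar>D i - D j\<bar> \<le> d (z i) (z j) \<and> d (z i) (z j) \<le> D i + D j)"
proof (intro iffI conjI allI)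
  assume "\<exists>x\<in>space M. \<forall>i. d x (z i) = D i"
  then obtain x where x: "x \<in> space M" "\<And>i. d x (z i) = D i" by blast
  show "\<exists>i. D i < 1 / real (Suc n)" for n
    using polish_metric_dense[OF x(1), of "1 / real (Suc n)"] x(2) by auto
  fix i j
  note z = polish_metric_centre
  show "\<bar>D i - D j\<bar> \<le> d (z i) (z j)"
    using D.triangle[OF x(1) z[of i] z[of j]] D.triangle[OF x(1) z[of j] z[of i]]
      D.commute[of "z i" "z j"] x(2) by simp
  show "d (z i) (z j) \<le> D i + D j"
    using D.triangle[OF z[of i] x(1) z[of j]] D.commute[of "z i" x] x(2) by simp
next
  assume "(\<forall>n. \<exists>i. D i < 1 / real (Suc n)) \<and>
     (\<forall>i j. \<bar>D i - D j\<bar> \<le> d (z i) (z j) \<and> d (z i) (z j) \<le> D i + D j)"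
  then have small: "\<And>n. \<exists>i. D i < 1 / real (Suc n)"
    and lip: "\<And>i j. \<bar>D i - D j\<bar> \<le> d (z i) (z j)"
    and tri: "\<And>i j. d (z i) (z j) \<le> D i + D j" by auto
  obtain s where s: "\<And>n. D (s n) < 1 / real (Suc n)" using small by metis
  have "D.MCauchy (\<lambda>n. z (s n))"
    unfolding D.MCauchy_def
  proof (intro conjI allI impI)
    show "range (\<lambda>n. z (s n)) \<subseteq> space M" using polish_metric_centre by auto
    fix e :: real assume "0 < e"
    then obtain k where k: "1 / real (Suc k) < e / 2" using nat_approx_posE[of "e / 2"] by auto
    show "\<exists>k. \<forall>n m. k \<le> n \<longrightarrow> k \<le> m \<longrightarrow> d (z (s n)) (z (s m)) < e"
    proof (intro exI allI impI)
      fix n m assume "k \<le> n" "k \<le> m"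
      then have "1 / real (Suc n) \<le> 1 / real (Suc k)" "1 / real (Suc m) \<le> 1 / real (Suc k)"
        by (auto intro!: divide_left_mono)
      with s[of n] s[of m] tri[of "s n" "s m"] k show "d (z (s n)) (z (s m)) < e" by linarith
    qed
  qed
  then obtain x where x: "limitin D.mtopology (\<lambda>n. z (s n)) x sequentially"
    using pm unfolding polish_metric_def D.mcomplete_def by blast
  then have xM: "x \<in> space M" using D.limitin_mspace by blast
  have dist0: "(\<lambda>n. d (z (s n)) x) \<longlonglongrightarrow> 0"
    using x unfolding D.limitin_metric_dist_null by blast
  have s0: "(\<lambda>n. 2 * (1 / real (Suc n)) + d (z (s n)) x) \<longlonglongrightarrow> 0"
    using tendsto_add[OF tendsto_mult[OF tendsto_const[of 2] LIMSEQ_Suc[OF lim_inverse_n]] dist0]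
    by (simp add: inverse_eq_divide)
  have "d x (z i) = D i" for i
  proof -
    have "\<bar>d x (z i) - D i\<bar> \<le> 2 * (1 / real (Suc n)) + d (z (s n)) x" for n
    proof -
      note z = polish_metric_centre
      have "\<bar>d x (z i) - d (z (s n)) (z i)\<bar> \<le> d (z (s n)) x"
        using D.triangle[OF xM z[of "s n"] z[of i]] D.triangle[OF z[of "s n"] xM z[of i]]
          D.commute[of x "z (s n)"] by simp
      moreover have "\<bar>d (z (s n)) (z i) - D i\<bar> \<le> D (s n)"
        using tri[of "s n" i] lip[of "s n" i] tri[of "s n" "s n"] D.nonneg[of "z (s n)" "z i"] by linarith
      ultimately show ?thesis using s[of n] tri[of "s n" "s n"] D.nonneg[of "z (s n)" "z (s n)"]
        by linarith
    qed
    then have "\<bar>d x (z i) - D i\<bar> \<le> 0"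
      by (intro LIMSEQ_le_const[OF s0]) auto
    then show ?thesis by simp
  qed
  with xM show "\<exists>x\<in>space M. \<forall>i. d x (z i) = D i" by blast
qed

end

text \<open>
  Each distance \<open>d (\<theta> y) (z i)\<close> is a function \<open>D i\<close> of \<open>\<xi> y\<close>. The point \<open>\<tau> w\<close> is the one with distances
  \<open>D i w\<close>; the set of those \<open>w\<close> for which it exists is measurable by completeness.
\<close>

theorem factor_map_of_Linf:
  assumes Z: "standard_borel Z" "space Z \<noteq> {}"
    and \<xi>: "\<xi> \<in> N \<rightarrow>\<^sub>M W" and \<theta>: "\<theta> \<in> N \<rightarrow>\<^sub>M Z"
    and factor: "\<And>F. F \<in> Linf Z \<Longrightarrow> \<exists>E\<in>Linf W. AE y in N. F (\<theta> y) = E (\<xi> y)"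
  obtains \<tau> where "\<tau> \<in> W \<rightarrow>\<^sub>M Z" "AE y in N. \<tau> (\<xi> y) = \<theta> y"
proof -
  obtain d z where pm: "polish_metric Z d z" by (rule standard_borel_polish_metric[OF Z])
  note iff = polish_metric_measurable_iff[OF pm]
  have "\<forall>i. \<exists>E\<in>Linf W. AE y in N. d (\<theta> y) (z i) = E (\<xi> y)"
    using factor[OF polish_metric_Linf[OF pm]] by blast
  then obtain D where D: "\<And>i. D i \<in> Linf W" "\<And>i. AE y in N. d (\<theta> y) (z i) = D i (\<xi> y)"
    by metis
  have [measurable]: "D i \<in> borel_measurable W" for i using D(1) by (simp add: Linf_def)
  \<comment> \<open>Off the null set where the equations for \<open>D\<close> fail, \<open>\<xi> y\<close> lies in \<open>W0\<close>.\<close>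
  define W0 where "W0 = {w\<in>space W. \<exists>x\<in>space Z. \<forall>i. d x (z i) = D i w}"
  have W0: "W0 \<in> sets W"
    unfolding W0_def polish_metric_point_of_distances[OF pm] by measurable
  define \<tau> where "\<tau> w = (if w \<in> W0 then (SOME x. x \<in> space Z \<and> (\<forall>i. d x (z i) = D i w)) else z 0)" for w
  have \<tau>: "\<tau> w \<in> space Z \<and> (\<forall>i. d (\<tau> w) (z i) = D i w)" if "w \<in> W0" for w
  proof -
    from that have "\<exists>x. x \<in> space Z \<and> (\<forall>i. d x (z i) = D i w)" by (auto simp: W0_def)
    from someI_ex[OF this] that show ?thesis by (simp add: \<tau>_def)
  qed
  have \<tau>0: "\<tau> w = z 0" if "w \<notin> W0" for w using that by (simp add: \<tau>_def)
  show ?thesis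
  proof (rule that)
    show "\<tau> \<in> W \<rightarrow>\<^sub>M Z"
      unfolding iff
    proof (intro conjI allI)
      show "\<tau> \<in> space W \<rightarrow> space Z"
        using \<tau> \<tau>0 polish_metric_centre[OF pm] by (metis Pi_I')
      fix i
      have "(\<lambda>w. if w \<in> W0 then D i w else d (z 0) (z i)) \<in> borel_measurable W"
        using W0 by measurable
      also have "(\<lambda>w. if w \<in> W0 then D i w else d (z 0) (z i)) = (\<lambda>w. d (\<tau> w) (z i))"
        using \<tau> \<tau>0 by auto
      finally show "(\<lambda>w. d (\<tau> w) (z i)) \<in> borel_measurable W" .
    qed
    have "AE y in N. \<forall>i. d (\<theta> y) (z i) = D i (\<xi> y)" using D(2) by (simp add: AE_all_countable)
    with AE_space show "AE y in N. \<tau> (\<xi> y) = \<theta> y"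
    proof eventually_elim
      case (elim y)
      have \<theta>y: "\<theta> y \<in> space Z" using elim \<theta> by (auto dest: measurable_space)
      have "\<xi> y \<in> W0" using elim \<theta>y measurable_space[OF \<xi>] by (auto simp: W0_def)
      from \<tau>[OF this] \<theta>y elim show ?case
        by (intro polish_metric_eqI[OF pm]) auto
    qed
  qed
qed

section \<open>Almost every translate\<close>

lemma G_spaceD:
  assumes "G_space act M"
  shows "prob_space M" "standard_borel M" "space M \<noteq> {}"
    and "(\<lambda>(g, x). act g x) \<in> borel \<Otimes>\<^sub>M M \<rightarrow>\<^sub>M M"
    and "x \<in> space M \<Longrightarrow> act 0 x = x"
    and "x \<in> space M \<Longrightarrow> act (g + h) x = act g (act h x)"
    and "A \<in> null_sets M \<Longrightarrow> act g ` A \<in> null_sets M"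
    and "x \<in> space M \<Longrightarrow> act g x \<in> space M"
proof -
  show 1: "prob_space M" "standard_borel M" "(\<lambda>(g, x). act g x) \<in> borel \<Otimes>\<^sub>M M \<rightarrow>\<^sub>M M"
    and "x \<in> space M \<Longrightarrow> act 0 x = x"
    and "x \<in> space M \<Longrightarrow> act (g + h) x = act g (act h x)"
    and "A \<in> null_sets M \<Longrightarrow> act g ` A \<in> null_sets M"
    using assms unfolding G_space_def standard_prob_space_def by simp_all
  show "space M \<noteq> {}" using 1(1) by (rule prob_space.not_empty)
  show "x \<in> space M \<Longrightarrow> act g x \<in> space M"
    using measurable_space[OF 1(3), of "(g, x)"] by (simp add: space_pair_measure)
qed

lemma G_space_act_uminus:
  assumes "G_space act M" "x \<in> space M"
  shows "act (- g) (act g x) = x" "act g (act (- g) x) = x"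
  using G_spaceD(6)[OF assms, of "- g" g] G_spaceD(6)[OF assms, of g "- g"] G_spaceD(5)[OF assms] by simp_all

lemma G_space_measurable_act:
  assumes "G_space act M" and f: "f \<in> N \<rightarrow>\<^sub>M borel" "p \<in> N \<rightarrow>\<^sub>M M"
  shows "(\<lambda>w. act (f w) (p w)) \<in> N \<rightarrow>\<^sub>M M"
proof -
  have "(\<lambda>w. (f w, p w)) \<in> N \<rightarrow>\<^sub>M borel \<Otimes>\<^sub>M M" using f by (rule measurable_Pair)
  from measurable_compose[OF this G_spaceD(4)[OF assms(1)]] show ?thesis by simp
qed

lemma G_space_AE_act:
  assumes "G_space act M" "AE x in M. P x"
  shows "AE x in M. P (act g x)"
proof -
  obtain N where N: "{x\<in>space M. \<not> P x} \<subseteq> N" "N \<in> null_sets M"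
    using assms(2) unfolding eventually_ae_filter by blast
  have "{x\<in>space M. \<not> P (act g x)} \<subseteq> act (- g) ` N"
  proof clarify
    fix x assume x: "x \<in> space M" "\<not> P (act g x)"
    then have "act g x \<in> N" using N(1) G_spaceD(8)[OF assms(1)] by auto
    moreover have "x = act (- g) (act g x)" using G_space_act_uminus[OF assms(1) x(1)] by simp
    ultimately show "x \<in> act (- g) ` N" by (rule image_eqI[rotated])
  qed
  with G_spaceD(7)[OF assms(1) N(2)] show ?thesis
    unfolding eventually_ae_filter by blast
qed

lemma standard_borel_equality_set:
  assumes "standard_borel M" "f \<in> N \<rightarrow>\<^sub>M M" "g \<in> N \<rightarrow>\<^sub>M M"
  shows "{x\<in>space N. f x = g x} \<in> sets N"
proof (cases "space M = {}")
  case True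
  then have "space N = {}" using measurable_space[OF assms(2)] by auto
  then show ?thesis by simp
next
  case False
  from standard_borel_polish_metric[OF assms(1) this] obtain d z where "polish_metric M d z" .
  from polish_metric_equality_set[OF this assms(2,3)] show ?thesis .
qed

lemma G_mapD:
  assumes "G_map actY N actX M p"
  shows "p \<in> N \<rightarrow>\<^sub>M M" "distr N M p = M" "AE y in N. p (actY g y) = actX g (p y)"
  using assms by (auto simp: G_map_def)

lemma G_map_AE:
  assumes "G_map actY N actX M p" "AE x in M. P x"
  shows "AE y in N. P (p y)"
  using AE_distrD[OF G_mapD(1)[OF assms(1)], of P] assms(2) unfolding G_mapD(2)[OF assms(1)] .

text \<open>
  A measure in the class of right Haar measure. Invariance of its null sets
  allows one to exchange "for each \<open>g\<close>, almost everywhere" and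
  "almost everywhere, for all \<open>g\<close>".
\<close>

locale right_quasi_invariant_prob =
  prob_space m for m :: "'g::{topological_group_add, t2_space, second_countable_topology} measure" +
  assumes sets_m [simp, measurable_cong]: "sets m = sets borel"
    and AE_shift: "(AE k in m. P k) \<Longrightarrow> (AE k in m. P (k + g))"
begin

lemma space_m [simp]: "space m = UNIV"
  using sets_eq_imp_space_eq[OF sets_m] by simp

lemma AE_imp_ex: "AE k in m. P k \<Longrightarrow> \<exists>k. P k"
  using AE_False by (metis (mono_tags, lifting) AE_mp AE_I2)

lemma AE_exchange:
  assumes M: "prob_space M"
    and P: "{p\<in>space (m \<Otimes>\<^sub>M M). P (fst p) (snd p)} \<in> sets (m \<Otimes>\<^sub>M M)"
    and ae: "\<And>k. AE x in M. P k x"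
  shows "AE x in M. AE k in m. P k x"
proof -
  interpret M: prob_space M by fact
  interpret pair_sigma_finite m M ..
  show ?thesis using AE_commute[OF P] ae by simp
qed

lemma G_space_AE_translates:
  assumes G: "G_space act M" and "AE x in M. P x"
  shows "AE x in M. AE k in m. P (act k x)"
proof -
  obtain N where N: "{x\<in>space M. \<not> P x} \<subseteq> N" "N \<in> null_sets M"
    using assms(2) unfolding eventually_ae_filter by blast
  have meas: "(\<lambda>p. act (fst p) (snd p)) \<in> m \<Otimes>\<^sub>M M \<rightarrow>\<^sub>M M"
    by (intro G_space_measurable_act[OF G]) measurable
  have "AE x in M. AE k in m. act k x \<notin> N"
  proof (rule AE_exchange[OF G_spaceD(1)[OF G]])
    have "{p \<in> space (m \<Otimes>\<^sub>M M). act (fst p) (snd p) \<notin> N}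
        = (\<lambda>p. act (fst p) (snd p)) -` (space M - N) \<inter> space (m \<Otimes>\<^sub>M M)"
      using measurable_space[OF meas] by auto
    also have "\<dots> \<in> sets (m \<Otimes>\<^sub>M M)" using N by (intro measurable_sets[OF meas]) auto
    finally show "{p \<in> space (m \<Otimes>\<^sub>M M). act (fst p) (snd p) \<notin> N} \<in> sets (m \<Otimes>\<^sub>M M)" .
    show "AE x in M. act k x \<notin> N" for k
      by (rule G_space_AE_act[OF G AE_not_in[OF N(2)]])
  qed
  with AE_space show ?thesis
  proof eventually_elim
    case (elim x)
    from elim(2) show ?case
      by eventually_elim (use N(1) elim(1) G_spaceD(8)[OF G] in auto)
  qed
qed

lemma G_map_AE_equivariant:
  assumes Y: "G_space actY N" and X: "G_space actX M" and p: "G_map actY N actX M p"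
  shows "AE y in N. AE k in m. p (actY k y) = actX k (p y)"
proof (rule AE_exchange[OF G_spaceD(1)[OF Y]])
  note [measurable] = G_mapD(1)[OF p]
  have "(\<lambda>q. p (actY (fst q) (snd q))) \<in> m \<Otimes>\<^sub>M N \<rightarrow>\<^sub>M M"
    by (rule measurable_compose[OF G_space_measurable_act[OF Y] G_mapD(1)[OF p]]) measurable
  moreover have "(\<lambda>q. actX (fst q) (p (snd q))) \<in> m \<Otimes>\<^sub>M N \<rightarrow>\<^sub>M M"
    by (rule G_space_measurable_act[OF X]) measurable
  ultimately show "{q \<in> space (m \<Otimes>\<^sub>M N). p (actY (fst q) (snd q)) = actX (fst q) (p (snd q))}
      \<in> sets (m \<Otimes>\<^sub>M N)"
    by (rule standard_borel_equality_set[OF G_spaceD(2)[OF X]])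
qed (rule G_mapD(3)[OF p])

text \<open>
  Averaging over \<open>k\<close> replaces the passage to a strictly equivariant version of \<open>p\<close>. For almost every \<open>y\<close>
  the integrand at \<open>g y\<close> is almost surely \<open>f' (g (p y))\<close>, for every \<open>g\<close>, because the equivariance of \<open>p\<close> is
  only used at \<open>k + g\<close>.
\<close>

theorem invariant_algebra_comp:
  fixes actY :: "'g \<Rightarrow> 'y \<Rightarrow> 'y" and actX :: "'g \<Rightarrow> 'x \<Rightarrow> 'x"
  assumes Y: "G_space actY N" and X: "G_space actX M" and p: "G_map actY N actX M p"
    and f: "f \<in> invariant_algebra actX M \<phi>"
  shows "f \<circ> p \<in> invariant_algebra actY N (\<phi> \<circ> p)"
proof -
  note [measurable] = G_mapD(1)[OF p]
  obtain f' where f': "f' \<in> Linf M" "AE x in M. f' x = f x"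
      "AE x in M. \<forall>g\<in>\<phi> x. f' (actX g x) = f' x"
    using f unfolding invariant_algebra_def by blast
  have [measurable]: "f \<in> borel_measurable M" "f' \<in> borel_measurable M"
    using f f'(1) by (auto simp: invariant_algebra_def Linf_def)
  obtain C where C: "AE x in M. \<bar>f x\<bar> \<le> C" using f by (auto simp: invariant_algebra_def Linf_def)
  define h where "h y = (\<integral>k. f' (actX (- k) (p (actY k y))) \<partial>m)" for y
  have joint: "(\<lambda>(y, k). f' (actX (- k) (p (actY k y)))) \<in> borel_measurable (N \<Otimes>\<^sub>M m)"
  proof -
    have 1: "(\<lambda>q. p (actY (snd q) (fst q))) \<in> N \<Otimes>\<^sub>M m \<rightarrow>\<^sub>M M"
      by (rule measurable_compose[OF G_space_measurable_act[OF Y] G_mapD(1)[OF p]]) measurable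
    have "(\<lambda>k::'g. - k) \<in> borel_measurable borel"
      by (intro borel_measurable_continuous_onI continuous_intros)
    then have "(\<lambda>q. - snd q) \<in> N \<Otimes>\<^sub>M m \<rightarrow>\<^sub>M borel"
      by (rule measurable_compose[rotated]) measurable
    from G_space_measurable_act[OF X this 1] show ?thesis
      unfolding split_def by measurable
  qed
  have h_meas: "h \<in> borel_measurable N"
    unfolding h_def by (rule borel_measurable_lebesgue_integral[OF joint])
  have h_eq: "h y = f' x"
    if y: "y \<in> space N" and ae: "AE k in m. f' (actX (- k) (p (actY k y))) = f' x" for y x
  proof -
    have "(\<lambda>k. f' (actX (- k) (p (actY k y)))) \<in> borel_measurable m"
      using measurable_Pair2[OF joint y] by simp
    then have "h y = (\<integral>k. f' x \<partial>m)"
      unfolding h_def using ae by (intro integral_cong_AE) auto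
    then show ?thesis using prob_space by simp
  qed
  have good: "AE y in N. h y = f' (p y) \<and> (\<forall>g\<in>\<phi> (p y). h (actY g y) = h y)"
    using AE_space G_map_AE_equivariant[OF Y X p] G_map_AE[OF p f'(3)]
  proof eventually_elim
    case (elim y)
    have py: "p y \<in> space M" using measurable_space[OF G_mapD(1)[OF p] elim(1)] .
    have h_gy: "h (actY g y) = f' (actX g (p y))" for g
    proof (rule h_eq)
      show "actY g y \<in> space N" using G_spaceD(8)[OF Y elim(1)] .
      show "AE k in m. f' (actX (- k) (p (actY k (actY g y)))) = f' (actX g (p y))"
        using AE_shift[OF elim(2), of g]
      proof eventually_elim
        case (elim k)
        have "p (actY k (actY g y)) = actX k (actX g (p y))"
          using elim G_spaceD(6)[OF Y \<open>y \<in> space N\<close>] G_spaceD(6)[OF X py] by simp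
        then show ?case
          using G_space_act_uminus(1)[OF X G_spaceD(8)[OF X py]] by simp
      qed
    qed
    have "h y = f' (p y)"
      using h_gy[of 0] G_spaceD(5)[OF Y elim(1)] G_spaceD(5)[OF X py] by simp
    with h_gy elim(3) show ?case by simp
  qed
  have hf: "AE y in N. h y = (f \<circ> p) y"
    using good G_map_AE[OF p f'(2)] by eventually_elim simp
  have bound: "AE y in N. \<bar>(f \<circ> p) y\<bar> \<le> C" using G_map_AE[OF p C] by simp
  have "f \<circ> p \<in> borel_measurable N" by measurable
  then have "f \<circ> p \<in> Linf N" unfolding Linf_def using bound by blast
  moreover have "h \<in> Linf N"
  proof -
    have "AE y in N. \<bar>h y\<bar> \<le> C" using hf bound by eventually_elim simp
    with h_meas show ?thesis unfolding Linf_def by blast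
  qed
  moreover have "AE y in N. \<forall>g\<in>(\<phi> \<circ> p) y. h (actY g y) = h y"
    using good by eventually_elim simp
  ultimately show ?thesis
    unfolding invariant_algebra_def using hf by blast
qed

text \<open>
  If \<open>g\<close> fixes \<open>y\<close>, then \<open>p ((k + g) y)\<close> and \<open>p (k y)\<close> coincide, and for almost every \<open>k\<close> they equal
  \<open>(k + g) (p y)\<close> and \<open>k (p y)\<close>.
\<close>

lemma G_map_stab_subset:
  fixes actY :: "'g \<Rightarrow> 'y \<Rightarrow> 'y" and actX :: "'g \<Rightarrow> 'x \<Rightarrow> 'x"
  assumes Y: "G_space actY N" and X: "G_space actX M" and p: "G_map actY N actX M p"
  shows "AE y in N. stab actY y \<subseteq> stab actX (p y)"
  using AE_space G_map_AE_equivariant[OF Y X p]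
proof eventually_elim
  case (elim y)
  have py: "p y \<in> space M" using elim(1) G_mapD(1)[OF p] by (auto dest: measurable_space)
  show ?case
  proof
    fix g assume "g \<in> stab actY y"
    then have gy: "actY g y = y" by (simp add: stab_def)
    have "AE k in m. p (actY k y) = actX k (p y) \<and> p (actY (k + g) y) = actX (k + g) (p y)"
      using elim(2) AE_shift[OF elim(2), of g] by eventually_elim simp
    then obtain k where k: "p (actY k y) = actX k (p y)" "p (actY (k + g) y) = actX (k + g) (p y)"
      using AE_imp_ex by blast
    then have "actX k (actX g (p y)) = actX k (p y)"
      using G_spaceD(6)[OF Y elim(1)] G_spaceD(6)[OF X py] gy by simp
    then have "actX g (p y) = p y"
      using G_space_act_uminus(1)[OF X] G_spaceD(8)[OF X py] py by metis
    then show "g \<in> stab actX (p y)" by (simp add: stab_def)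
  qed
qed

text \<open>
  The distances \<open>d (\<xi> y) (z i)\<close> belong to the pullback algebra, so they have invariant
  representatives \<open>f i\<close>. For almost every \<open>k\<close> these agree with the distances at \<open>k y\<close> and at \<open>(k + g) y\<close>, and
  the second point is \<open>k + g - k\<close> applied to the first one; hence \<open>\<xi>\<close> takes the same value at both.
\<close>

theorem quotient_space_over_subset_stab:
  assumes Y: "G_space actY N" and q: "quotient_space_over actY N \<Phi> actW W \<xi>"
    and equi: "AE y in N. AE k in m. \<forall>g\<in>\<Phi> y. k + g - k \<in> \<Phi> (actY k y)"
  shows "AE y in N. \<Phi> y \<subseteq> stab actW (\<xi> y)"
proof -
  have W: "G_space actW W" and \<xi>: "G_map actY N actW W \<xi>"
    and alg: "invariant_algebra actY N \<Phi> = pullback_algebra N W \<xi>"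
    using q by (auto simp: quotient_space_over_def)
  obtain d z where pm: "polish_metric W d z"
    by (rule standard_borel_polish_metric[OF G_spaceD(2,3)[OF W]])
  have "\<forall>i. \<exists>f. (AE y in N. f y = d (\<xi> y) (z i)) \<and> (AE y in N. \<forall>g\<in>\<Phi> y. f (actY g y) = f y)"
  proof
    fix i
    have "(\<lambda>y. d (\<xi> y) (z i)) \<in> borel_measurable N"
      using G_mapD(1)[OF \<xi>] unfolding polish_metric_measurable_iff[OF pm] by simp
    then have "(\<lambda>y. d (\<xi> y) (z i)) \<in> Linf N"
      unfolding Linf_def using polish_metric_nonneg[OF pm] polish_metric_le_1[OF pm]
      by (auto intro!: exI[of _ 1])
    then have "(\<lambda>y. d (\<xi> y) (z i)) \<in> invariant_algebra actY N \<Phi>"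
      unfolding alg pullback_algebra_def using polish_metric_Linf[OF pm, of i]
      by (intro CollectI conjI bexI[of _ "\<lambda>w. d w (z i)"]) auto
    then have "\<exists>f\<in>Linf N. (AE y in N. f y = d (\<xi> y) (z i)) \<and>
        (AE y in N. \<forall>g\<in>\<Phi> y. f (actY g y) = f y)"
      by (simp add: invariant_algebra_def)
    then obtain f where "AE y in N. f y = d (\<xi> y) (z i)"
        "AE y in N. \<forall>g\<in>\<Phi> y. f (actY g y) = f y"
      by (elim bexE conjE)
    then show "\<exists>f. (AE y in N. f y = d (\<xi> y) (z i)) \<and>
        (AE y in N. \<forall>g\<in>\<Phi> y. f (actY g y) = f y)"
      by (intro exI[of _ f] conjI)
  qed
  from choice[OF this] obtain f where f: "\<And>i. AE y in N. f i y = d (\<xi> y) (z i)"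
      "\<And>i. AE y in N. \<forall>g\<in>\<Phi> y. f i (actY g y) = f i y"
    by auto
  have all: "AE y in N. \<forall>i. f i y = d (\<xi> y) (z i)"
      "AE y in N. \<forall>i. \<forall>g\<in>\<Phi> y. f i (actY g y) = f i y"
    using f by (simp_all add: AE_all_countable)
  show ?thesis
    using AE_space G_space_AE_translates[OF Y all(1)] G_space_AE_translates[OF Y all(2)]
      G_map_AE_equivariant[OF Y W \<xi>] equi
  proof eventually_elim
    case (elim y)
    have \<xi>y: "\<xi> y \<in> space W" using elim(1) G_mapD(1)[OF \<xi>] by (auto dest: measurable_space)
    show ?case
    proof
      fix g assume g: "g \<in> \<Phi> y"
      have "AE k in m. actW (k + g) (\<xi> y) = actW k (\<xi> y)"
        using elim(2) AE_shift[OF elim(2), of g] elim(3,4) AE_shift[OF elim(4), of g] elim(5)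
      proof eventually_elim
        case k: (elim k)
        have ky: "actY k y \<in> space N" using G_spaceD(8)[OF Y \<open>y \<in> space N\<close>] .
        have "actY (k + g - k) (actY k y) = actY (k + g) y"
          using G_spaceD(6)[OF Y \<open>y \<in> space N\<close>, of "k + g - k" k] by simp
        then have "f i (actY (k + g) y) = f i (actY k y)" for i
          using k(3,6) g by metis
        then have "d (\<xi> (actY (k + g) y)) (z i) = d (\<xi> (actY k y)) (z i)" for i
          using k(1,2) by simp
        then have "d (actW (k + g) (\<xi> y)) (z i) = d (actW k (\<xi> y)) (z i)" for i
          using k(4,5) by simp
        then show ?case
          by (intro polish_metric_eqI[OF pm] G_spaceD(8)[OF W \<xi>y])
      qed
      then obtain k where "actW (k + g) (\<xi> y) = actW k (\<xi> y)" using AE_imp_ex by blast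
      then have "actW k (actW g (\<xi> y)) = actW k (\<xi> y)" using G_spaceD(6)[OF W \<xi>y] by simp
      then have "actW g (\<xi> y) = \<xi> y"
        using G_space_act_uminus(1)[OF W] G_spaceD(8)[OF W \<xi>y] \<xi>y by metis
      then show "g \<in> stab actW (\<xi> y)" by (simp add: stab_def)
    qed
  qed
qed

end

section \<open>Measurability of stabilizer inclusions\<close>

lemma eventually_translate_subset:
  fixes K :: "'g::topological_group_add set"
  assumes "compact K" "open U" "K \<subseteq> U"
  shows "\<forall>\<^sub>F s in nhds 0. \<forall>k\<in>K. k + s \<in> U"
proof -
  have "\<forall>k\<in>K. \<exists>A S. open A \<and> k \<in> A \<and> open S \<and> 0 \<in> S \<and> (\<forall>a\<in>A. \<forall>s\<in>S. a + s \<in> U)"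
  proof
    fix k assume k: "k \<in> K"
    have "((\<lambda>p. fst p + snd p) \<longlongrightarrow> k + 0) (nhds k \<times>\<^sub>F nhds 0)"
      by (intro tendsto_add filterlim_fst filterlim_snd)
    then have "\<forall>\<^sub>F p in nhds k \<times>\<^sub>F nhds 0. fst p + snd p \<in> U"
      using assms k by (auto simp: tendsto_def)
    then obtain P Q where PQ: "eventually P (nhds k)" "eventually Q (nhds 0)"
        "\<And>a s. P a \<Longrightarrow> Q s \<Longrightarrow> a + s \<in> U"
      unfolding eventually_prod_filter by auto
    obtain A where A: "open A" "k \<in> A" "\<forall>a\<in>A. P a" using PQ(1) unfolding eventually_nhds by blast
    obtain S where S: "open S" "0 \<in> S" "\<forall>s\<in>S. Q s" using PQ(2) unfolding eventually_nhds by blast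
    show "\<exists>A S. open A \<and> k \<in> A \<and> open S \<and> 0 \<in> S \<and> (\<forall>a\<in>A. \<forall>s\<in>S. a + s \<in> U)"
      by (rule exI[of _ A], rule exI[of _ S]) (use A S PQ(3) in simp)
  qed
  then obtain A S where "\<forall>k\<in>K. open (A k) \<and> k \<in> A k \<and> open (S k) \<and> 0 \<in> S k \<and>
      (\<forall>a\<in>A k. \<forall>s\<in>S k. a + s \<in> U)"
    by metis
  then have AS: "\<And>k. k \<in> K \<Longrightarrow> open (A k)" "\<And>k. k \<in> K \<Longrightarrow> k \<in> A k"
      "\<And>k. k \<in> K \<Longrightarrow> open (S k)" "\<And>k. k \<in> K \<Longrightarrow> 0 \<in> S k"
      "\<And>k a s. k \<in> K \<Longrightarrow> a \<in> A k \<Longrightarrow> s \<in> S k \<Longrightarrow> a + s \<in> U"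
    by auto
  have "K \<subseteq> (\<Union>k\<in>K. A k)" using AS(2) by blast
  from compactE_image[OF assms(1) AS(1) this] obtain C where C: "C \<subseteq> K" "finite C" "K \<subseteq> (\<Union>k\<in>C. A k)"
    by metis
  have "\<forall>\<^sub>F s in nhds 0. \<forall>k\<in>C. s \<in> S k"
    using C AS(3,4) by (intro eventually_ball_finite ballI eventually_nhds_in_open) auto
  then show ?thesis
  proof eventually_elim
    case (elim s)
    show ?case
    proof
      fix k assume "k \<in> K"
      then obtain c where "c \<in> C" "k \<in> A c" using C(3) by blast
      with elim C(1) AS(5) show "k + s \<in> U" by blast
    qed
  qed
qed

context right_haar_group
begin

text \<open>
  If \<open>K\<close> is a compact subset of \<open>U\<close> whose measure is almost that of \<open>U\<close>, then small translates of \<open>K\<close> stay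
  in \<open>U\<close>, so \<open>U\<close> and its small translates differ at most by \<open>U - K\<close> and a translate of it.
\<close>

lemma haar_translation_continuous:
  assumes U: "open U" "emeasure \<mu> U < \<infinity>"
  shows "((\<lambda>s. \<integral>k. \<bar>indicator U k - indicator U (k + s)\<bar> \<partial>\<mu>) \<longlongrightarrow> (0::real)) (nhds 0)"
proof (rule tendstoI)
  fix e :: real assume e: "0 < e"
  have Um [measurable]: "U \<in> sets borel" using U(1) by simp
  obtain K where K: "compact K" "K \<subseteq> U" "measure \<mu> U - measure \<mu> K < e / 2"
  proof (cases "measure \<mu> U = 0")
    case True
    then show ?thesis using that[of "{}"] e by simp
  next
    case False
    have "ennreal (measure \<mu> U - e / 2) < emeasure \<mu> U"
      using U(2) e False measure_nonneg[of \<mu> U]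
      by (auto simp: emeasure_eq_ennreal_measure less_top zero_less_measure_iff intro!: ennreal_lessI)
    also have "\<dots> = (SUP K\<in>{K. compact K \<and> K \<subseteq> U}. emeasure \<mu> K)" by (rule haar_inner[OF U(1)])
    finally obtain K where K: "compact K" "K \<subseteq> U" "ennreal (measure \<mu> U - e / 2) < emeasure \<mu> K"
      by (auto simp: less_SUP_iff)
    have "emeasure \<mu> K = ennreal (measure \<mu> K)"
      using haar_compact[OF K(1)] by (simp add: emeasure_eq_ennreal_measure)
    with K(3) have "measure \<mu> U - e / 2 < measure \<mu> K" by (metis ennreal_leI not_le)
    with K show ?thesis by (intro that[of K]) auto
  qed
  have [measurable]: "K \<in> sets borel" using K(1) by (simp add: compact_imp_closed borel_closed)
  have UK: "measure \<mu> (U - K) < e / 2"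
    using K U(2) by (subst measure_Diff) (auto simp: less_top)
  have ev: "\<forall>\<^sub>F s in nhds 0. \<forall>k\<in>K. k + s \<in> U" by (rule eventually_translate_subset) fact+
  have "((\<lambda>s. - s) \<longlongrightarrow> - 0) (nhds (0::'g))" by (intro tendsto_minus filterlim_ident)
  then have "filterlim (\<lambda>s. - s) (nhds 0) (nhds (0::'g))" by simp
  then have ev': "\<forall>\<^sub>F s in nhds 0. \<forall>k\<in>K. k + (- s) \<in> U"
    by (rule eventually_compose_filterlim[OF ev])
  show "\<forall>\<^sub>F s in nhds 0. dist (\<integral>k. \<bar>indicator U k - indicator U (k + s)\<bar> \<partial>\<mu>) (0::real) < e"
    using ev ev'
  proof eventually_elim
    case (elim s)
    have int: "integrable \<mu> (indicator (U - K) :: 'g \<Rightarrow> real)"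
      using U(2) by (intro integrable_real_indicator) (auto intro: le_less_trans[OF emeasure_mono])
    have int': "integrable \<mu> (\<lambda>k. indicator (U - K) (k + s) :: real)"
      using integrable_distr[OF shift_measurable_haar[of s], of "indicator (U - K) :: 'g \<Rightarrow> real"]
        int by (simp add: haar_distr)
    have "(\<integral>k. \<bar>indicator U k - indicator U (k + s)\<bar> \<partial>\<mu>)
        \<le> (\<integral>k. (indicator (U - K) k + indicator (U - K) (k + s) :: real) \<partial>\<mu>)"
    proof (rule integral_mono')
      show "integrable \<mu> (\<lambda>k. (indicator (U - K) k + indicator (U - K) (k + s) :: real))"
        using int int' by simp
      fix k
      have "k \<in> K \<Longrightarrow> k + s \<in> U" using elim by auto
      moreover have "k + s \<in> K \<Longrightarrow> k \<in> U" using elim(2)[rule_format, of "k + s"] by (simp add: add.assoc)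
      ultimately show "\<bar>indicator U k - indicator U (k + s)\<bar>
          \<le> (indicator (U - K) k + indicator (U - K) (k + s) :: real)"
        by (auto simp: indicator_def)
    qed auto
    also have "\<dots> = measure \<mu> (U - K) + (\<integral>k. indicator (U - K) (k + s) \<partial>\<mu>)"
      using int int' by simp
    also have "(\<integral>k. indicator (U - K) (k + s) \<partial>\<mu>) = measure \<mu> (U - K)"
      by (subst haar_integral_shift) auto
    finally show ?case using UK by (simp add: dist_real_def)
  qed
qed

lemma AE_eq_of_integrals_on_basis:
  fixes u v :: "'g \<Rightarrow> real"
  assumes B: "countable B" "topological_basis B" "\<And>U V. U \<in> B \<Longrightarrow> V \<in> B \<Longrightarrow> U \<inter> V \<in> B"
      "\<And>U. U \<in> B \<Longrightarrow> emeasure \<mu> U < \<infinity>"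
    and u: "u \<in> borel_measurable borel" "\<And>k. 0 \<le> u k" "\<And>k. u k \<le> 1"
    and v: "v \<in> borel_measurable borel" "\<And>k. 0 \<le> v k" "\<And>k. v k \<le> 1"
    and eq: "\<And>U. U \<in> B \<Longrightarrow> (\<integral>k. indicator U k * u k \<partial>\<mu>) = (\<integral>k. indicator U k * v k \<partial>\<mu>)"
  shows "AE k in \<mu>. u k = v k"
proof -
  have BU: "U \<in> sets borel" if "U \<in> B" for U
    using topological_basis_open[OF B(2) that] by simp
  have em: "emeasure (density \<mu> (\<lambda>k. ennreal (w k))) U = ennreal (\<integral>k. indicator U k * w k \<partial>\<mu>)"
    if U: "U \<in> B" and w: "w \<in> borel_measurable borel" "\<And>k. 0 \<le> w k" "\<And>k. w k \<le> 1" for U w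
  proof -
    note [measurable] = BU[OF U] w(1)
    have "integrable \<mu> (indicator U :: 'g \<Rightarrow> real)"
      using B(4)[OF U] by (intro integrable_real_indicator) auto
    then have int: "integrable \<mu> (\<lambda>k. indicator U k * w k)"
      by (rule Bochner_Integration.integrable_bound)
        (use w(2,3) in \<open>auto simp: indicator_def\<close>)
    have "emeasure (density \<mu> (\<lambda>k. ennreal (w k))) U = (\<integral>\<^sup>+k. ennreal (indicator U k * w k) \<partial>\<mu>)"
      by (subst emeasure_density) (auto intro!: nn_integral_cong simp: indicator_def)
    also have "\<dots> = ennreal (\<integral>k. indicator U k * w k \<partial>\<mu>)"
      using w(2) by (intro nn_integral_eq_integral int) auto
    finally show ?thesis .
  qed
  have borel: "sets (borel :: 'g measure) = sigma_sets UNIV B"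
    by (metis borel_eq_countable_basis[OF B(1,2)] sets_measure_of subset_UNIV Pow_UNIV)
  have cover: "\<Union>B = UNIV"
  proof -
    have "x \<in> \<Union>B" for x by (rule topological_basisE[OF B(2), of UNIV x]) auto
    then show ?thesis by blast
  qed
  have "density \<mu> (\<lambda>k. ennreal (u k)) = density \<mu> (\<lambda>k. ennreal (v k))"
  proof (rule measure_eqI_generator_eq_countable[where \<Omega> = UNIV and E = B and A = B])
    show "Int_stable B" using B(3) by (simp add: Int_stable_def)
    show "emeasure (density \<mu> (\<lambda>k. ennreal (u k))) U = emeasure (density \<mu> (\<lambda>k. ennreal (v k))) U"
      if "U \<in> B" for U using that by (simp add: em u v eq)
    show "emeasure (density \<mu> (\<lambda>k. ennreal (u k))) U \<noteq> \<infinity>" if "U \<in> B" for U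
      using that by (simp add: em u)
  qed (use B(1) cover borel in auto)
  then have "AE k in \<mu>. ennreal (u k) = ennreal (v k)"
    using u(1) v(1) by (intro density_unique) auto
  then show ?thesis by eventually_elim (use u(2) v(2) in simp)
qed

text \<open>
  The functions are \<open>\<integral>k\<in>U. d ((k + g) x) (z i)\<close> minus the same integral for \<open>g = 0\<close>, for \<open>U\<close> in a countable
  basis. By invariance the first integral is one over \<open>U + g\<close>, so it is continuous in \<open>g\<close> although the action
  is merely measurable. If all differences vanish, then \<open>(k + g) x = k x\<close> for almost every \<open>k\<close>, and
  one such \<open>k\<close> suffices for \<open>g x = x\<close>.
\<close>

theorem stabilizer_functions:
  fixes act :: "'g \<Rightarrow> 'x \<Rightarrow> 'x"
  assumes G: "G_space act M"
  obtains c :: "nat \<Rightarrow> 'x \<Rightarrow> 'g \<Rightarrow> real" where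
    "\<And>p g. (\<lambda>x. c p x g) \<in> borel_measurable M"
    "\<And>p x. x \<in> space M \<Longrightarrow> continuous_on UNIV (c p x)"
    "\<And>x g. x \<in> space M \<Longrightarrow> g \<in> stab act x \<longleftrightarrow> (\<forall>p. c p x g = 0)"
proof -
  obtain B :: "'g set set" where B: "countable B" "topological_basis B"
      "\<And>U V. U \<in> B \<Longrightarrow> V \<in> B \<Longrightarrow> U \<inter> V \<in> B" "\<And>U. U \<in> B \<Longrightarrow> \<exists>K. compact K \<and> U \<subseteq> K"
    by (rule relatively_compact_basis) blast
  have fin: "emeasure \<mu> U < \<infinity>" if U: "U \<in> B" for U
  proof -
    obtain K where "compact K" "U \<subseteq> K" using B(4)[OF U] by blast
    then show ?thesis by (rule haar_relatively_compact_finite)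
  qed
  have op: "open U" if "U \<in> B" for U using topological_basis_open[OF B(2) that] .
  have "B \<noteq> {}" using topological_basisE[OF B(2), of UNIV 0] by auto
  obtain d z where pm: "polish_metric M d z"
    by (rule standard_borel_polish_metric[OF G_spaceD(2,3)[OF G]])
  note d01 = polish_metric_nonneg[OF pm] polish_metric_le_1[OF pm]
  define V where "V i U x g = (\<integral>k. indicator U k * d (act (k + g) x) (z i) \<partial>\<mu>)" for i U x g
  have d_joint: "(\<lambda>(x, k). d (act (k + g) x) (z i)) \<in> borel_measurable (M \<Otimes>\<^sub>M \<mu>)" for g i
  proof -
    have "(\<lambda>q. act (snd q + g) (fst q)) \<in> M \<Otimes>\<^sub>M \<mu> \<rightarrow>\<^sub>M M"
      by (rule G_space_measurable_act[OF G]) measurable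
    from measurable_compose[OF this polish_metric_borel_measurable[OF pm]]
    show ?thesis by (simp add: split_def)
  qed
  have d_act: "(\<lambda>k. d (act (k + g) x) (z i)) \<in> borel_measurable borel" if "x \<in> space M" for x g i
    using measurable_Pair2[OF d_joint that, of g i] by simp
  have V_meas: "(\<lambda>x. V i U x g) \<in> borel_measurable M" if "U \<in> B" for i U g
  proof -
    have [measurable]: "U \<in> sets borel" using op[OF that] by simp
    show ?thesis
      unfolding V_def
      by (rule borel_measurable_lebesgue_integral) (use d_joint in \<open>simp add: split_def\<close>)
  qed
  have V_cont: "continuous_on UNIV (V i U x)" if x: "x \<in> space M" and U: "U \<in> B" for i U x
  proof -
    have [measurable]: "U \<in> sets borel" using op[OF U] by simp
    define u where "u k = d (act k x) (z i)" for k
    have [measurable]: "u \<in> borel_measurable borel"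
      using d_act[OF x, of 0 i] by (simp add: u_def[abs_def])
    have u01: "0 \<le> u k" "u k \<le> 1" for k using d01 by (simp_all add: u_def)
    have intU: "integrable \<mu> (\<lambda>k. indicator U (k + s) :: real)" for s
      using integrable_distr[OF shift_measurable_haar[of s], of "indicator U :: 'g \<Rightarrow> real"]
        fin[OF U] by (simp add: haar_distr integrable_real_indicator)
    have V_eq: "V i U x g = (\<integral>k. indicator U (k + (- g)) * u k \<partial>\<mu>)" for g
    proof -
      have "(\<lambda>k. indicator U (k + (- g)) * u k) \<in> borel_measurable borel" by measurable
      from haar_integral_shift[OF this, of g] show ?thesis by (simp add: V_def u_def add.assoc)
    qed
    have V_int: "integrable \<mu> (\<lambda>k. indicator U (k + s) * u k)" for s
      using intU[of s] by (rule Bochner_Integration.integrable_bound)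
        (use u01 in \<open>auto simp: indicator_def\<close>)
    have bound: "dist (V i U x g) (V i U x h) \<le> (\<integral>k. \<bar>indicator U k - indicator U (k + (g - h))\<bar> \<partial>\<mu>)"
      for g h
    proof -
      have "V i U x g - V i U x h
          = (\<integral>k. indicator U (k + (- g)) * u k - indicator U (k + (- h)) * u k \<partial>\<mu>)"
        by (simp only: V_eq Bochner_Integration.integral_diff[OF V_int V_int])
      then have "dist (V i U x g) (V i U x h)
          \<le> (\<integral>k. \<bar>indicator U (k + (- g)) * u k - indicator U (k + (- h)) * u k\<bar> \<partial>\<mu>)"
        unfolding dist_real_def by (metis integral_abs_bound)
      also have "\<dots> \<le> (\<integral>k. \<bar>indicator U (k + (- g)) - indicator U (k + (- h))\<bar> \<partial>\<mu>)"
        by (intro integral_mono integrable_abs Bochner_Integration.integrable_diff V_int intU)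
          (use u01 in \<open>auto simp: indicator_def\<close>)
      also have "\<dots> = (\<integral>k. \<bar>indicator U k - indicator U (k + (g - h))\<bar> \<partial>\<mu>)"
      proof -
        have "(\<lambda>k. \<bar>indicator U (k + (- g)) - indicator U (k + (- h)) :: real\<bar>) \<in> borel_measurable borel"
          by measurable
        from haar_integral_shift[OF this, of g] show ?thesis
          by (simp add: add.assoc algebra_simps)
      qed
      finally show ?thesis .
    qed
    have "(V i U x \<longlongrightarrow> V i U x h) (nhds h)" for h
    proof (rule tendstoI)
      fix e :: real assume "0 < e"
      with haar_translation_continuous[OF op[OF U] fin[OF U]]
      have small: "\<forall>\<^sub>F s in nhds 0. dist (\<integral>k. \<bar>indicator U k - indicator U (k + s)\<bar> \<partial>\<mu>) (0::real) < e"
        by (auto dest: tendstoD)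
      have "((\<lambda>g. g - h) \<longlongrightarrow> h - h) (nhds h)" by (intro tendsto_intros filterlim_ident)
      then have "filterlim (\<lambda>g. g - h) (nhds 0) (nhds h)" by simp
      from eventually_compose_filterlim[OF small this]
      show "\<forall>\<^sub>F g in nhds h. dist (V i U x g) (V i U x h) < e"
      proof eventually_elim
        case (elim g)
        with bound[of g h] show ?case by (simp add: dist_real_def)
      qed
    qed
    then show ?thesis
      unfolding continuous_on_def at_within_def by (intro ballI tendsto_mono[OF inf_le1])
  qed
  define c where "c p x g = (let (i, j) = prod_decode p; U = from_nat_into B j in V i U x g - V i U x 0)"
    for p x g
  have c: "c p x g = V (fst (prod_decode p)) (from_nat_into B (snd (prod_decode p))) x g
      - V (fst (prod_decode p)) (from_nat_into B (snd (prod_decode p))) x 0" for p x g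
    by (simp add: c_def split_def Let_def)
  note inB = from_nat_into[OF \<open>B \<noteq> {}\<close>]
  show ?thesis
  proof (rule that)
    show "(\<lambda>x. c p x g) \<in> borel_measurable M" for p g
      unfolding c by (intro borel_measurable_diff V_meas inB)
    show "continuous_on UNIV (c p x)" if "x \<in> space M" for p x
      unfolding c[abs_def] by (intro continuous_on_diff continuous_on_const V_cont that inB)
    show "g \<in> stab act x \<longleftrightarrow> (\<forall>p. c p x g = 0)" if x: "x \<in> space M" for x g
    proof
      assume "g \<in> stab act x"
      then have "act (k + g) x = act (k + 0) x" for k
        using G_spaceD(6)[OF G x] by (simp add: stab_def)
      then show "\<forall>p. c p x g = 0" by (simp add: c V_def)
    next
      assume c0: "\<forall>p. c p x g = 0"
      have "V i U x g = V i U x 0" if U: "U \<in> B" for i U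
      proof -
        obtain j where "from_nat_into B j = U" using from_nat_into_surj[OF B(1) U] by blast
        with c0[rule_format, of "prod_encode (i, j)"] show ?thesis by (simp add: c)
      qed
      then have "AE k in \<mu>. d (act (k + g) x) (z i) = d (act (k + 0) x) (z i)" for i
        using d01 by (intro AE_eq_of_integrals_on_basis[OF B(1,2,3) fin] d_act x) (auto simp: V_def)
      then have "AE k in \<mu>. \<forall>i. d (act (k + g) x) (z i) = d (act (k + 0) x) (z i)"
        by (simp add: AE_all_countable)
      then have ae: "AE k in \<mu>. act (k + g) x = act (k + 0) x"
        by eventually_elim (intro polish_metric_eqI[OF pm] G_spaceD(8)[OF G x], blast)
      have "\<exists>k. act (k + g) x = act (k + 0) x"
      proof (rule ccontr)
        assume "\<nexists>k. act (k + g) x = act (k + 0) x"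
        with ae have "AE k in \<mu>. False" by simp
        with haar_nonzero AE_iff_measurable[of UNIV \<mu> "\<lambda>_. False"] show False by simp
      qed
      then obtain k where "act k (act g x) = act k x" using G_spaceD(6)[OF G x] by auto
      then have "act g x = x"
        using G_space_act_uminus(1)[OF G] G_spaceD(8)[OF G x] x by metis
      then show "g \<in> stab act x" by (simp add: stab_def)
    qed
  qed
qed

end

text \<open>
  Let \<open>a\<close> and \<open>c\<close> be stabilizer functions of \<open>Z\<close> and \<open>W\<close>. On a relatively compact set the inclusion of the zero
  set of \<open>a (\<tau> w)\<close> in that of \<open>c w\<close> is equivalent to a uniform one: if finitely many \<open>a r (\<tau> w) g\<close> are small, so is
  \<open>c p w g\<close>. By continuity in \<open>g\<close> the uniform condition need only be tested on a countable dense
  set.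
\<close>

lemma (in right_haar_group) stab_subset_stab_measurable:
  fixes actW :: "'g \<Rightarrow> 'w \<Rightarrow> 'w" and actZ :: "'g \<Rightarrow> 'z \<Rightarrow> 'z"
  assumes W: "G_space actW W" and Z: "G_space actZ Z" and \<tau>: "\<tau> \<in> W \<rightarrow>\<^sub>M Z"
  shows "{w\<in>space W. stab actZ (\<tau> w) \<subseteq> stab actW w} \<in> sets W"
proof -
  obtain a :: "nat \<Rightarrow> 'z \<Rightarrow> 'g \<Rightarrow> real" where a: "\<And>p g. (\<lambda>x. a p x g) \<in> borel_measurable Z"
      "\<And>p x. x \<in> space Z \<Longrightarrow> continuous_on UNIV (a p x)"
      "\<And>x g. x \<in> space Z \<Longrightarrow> g \<in> stab actZ x \<longleftrightarrow> (\<forall>p. a p x g = 0)"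
    by (rule stabilizer_functions[OF Z]) blast
  obtain c :: "nat \<Rightarrow> 'w \<Rightarrow> 'g \<Rightarrow> real" where c: "\<And>p g. (\<lambda>x. c p x g) \<in> borel_measurable W"
      "\<And>p x. x \<in> space W \<Longrightarrow> continuous_on UNIV (c p x)"
      "\<And>x g. x \<in> space W \<Longrightarrow> g \<in> stab actW x \<longleftrightarrow> (\<forall>p. c p x g = 0)"
    by (rule stabilizer_functions[OF W]) blast
  obtain B :: "'g set set" where B: "countable B" "topological_basis B"
      "\<And>U. U \<in> B \<Longrightarrow> \<exists>K. compact K \<and> U \<subseteq> K"
    by (rule relatively_compact_basis) blast
  obtain D :: "'g set" where D: "countable D" "\<And>X. open X \<Longrightarrow> X \<noteq> {} \<Longrightarrow> \<exists>d\<in>D. d \<in> X"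
    by (rule countable_dense_setE) blast
  define near where "near q w g \<longleftrightarrow> (\<forall>r\<le>q. \<bar>a r (\<tau> w) g\<bar> < 1 / real (Suc q))" for q w g
  \<comment> \<open>The index \<open>q\<close> plays two parts: it is the number of functions tested and the inverse of the tolerance.\<close>
  define S where "S w \<longleftrightarrow> (\<forall>U\<in>B. \<forall>p n. \<exists>q. \<forall>g\<in>D. g \<in> U \<and> near q w g \<longrightarrow> \<bar>c p w g\<bar> \<le> 1 / real (Suc n))" for w
  have "stab actZ (\<tau> w) \<subseteq> stab actW w \<longleftrightarrow> S w" if w: "w \<in> space W" for w
  proof
    have \<tau>w: "\<tau> w \<in> space Z" using measurable_space[OF \<tau> w] .
    show "S w" if incl: "stab actZ (\<tau> w) \<subseteq> stab actW w"
    proof (rule ccontr)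
      assume "\<not> S w"
      then obtain U p n where U: "U \<in> B"
          and "\<forall>q. \<exists>g. g \<in> U \<and> near q w g \<and> \<not> \<bar>c p w g\<bar> \<le> 1 / real (Suc n)"
        unfolding S_def by blast
      then obtain s where s: "\<And>q. s q \<in> U" "\<And>q. near q w (s q)"
          "\<And>q. 1 / real (Suc n) \<le> \<bar>c p w (s q)\<bar>"
        by (metis linear)
      \<comment> \<open>A violation for each \<open>q\<close> accumulates at a point \<open>l\<close> that stabilizes \<open>\<tau> w\<close> and not \<open>w\<close>.\<close>
      obtain K where K: "compact K" "U \<subseteq> K" using B(3)[OF U] by blast
      then have "\<forall>q. s q \<in> K" using s(1) by blast
      with compact_imp_seq_compact[OF K(1)] obtain l \<sigma> where \<sigma>: "strict_mono \<sigma>" "(s \<circ> \<sigma>) \<longlonglongrightarrow> l"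
        unfolding seq_compact_def by blast
      have "a r (\<tau> w) l = 0" for r
      proof -
        have lim: "(\<lambda>m. \<bar>a r (\<tau> w) ((s \<circ> \<sigma>) m)\<bar>) \<longlonglongrightarrow> \<bar>a r (\<tau> w) l\<bar>"
          by (intro tendsto_rabs continuous_on_tendsto_compose[OF a(2)[OF \<tau>w] \<sigma>(2)]) auto
        have "\<forall>\<^sub>F m in sequentially. \<bar>a r (\<tau> w) ((s \<circ> \<sigma>) m)\<bar> \<le> 1 / real (Suc m)"
          using eventually_ge_at_top[of r]
        proof eventually_elim
          case (elim m)
          then have "r \<le> \<sigma> m" "m \<le> \<sigma> m" using seq_suble[OF \<sigma>(1), of m] by auto
          then have "\<bar>a r (\<tau> w) (s (\<sigma> m))\<bar> < 1 / real (Suc (\<sigma> m))"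
            using s(2)[of "\<sigma> m"] by (simp add: near_def)
          also have "\<dots> \<le> 1 / real (Suc m)"
            using \<open>m \<le> \<sigma> m\<close> by (intro divide_left_mono) auto
          finally show ?case by simp
        qed
        moreover have "(\<lambda>m. 1 / real (Suc m)) \<longlonglongrightarrow> 0"
          using LIMSEQ_Suc[OF lim_inverse_n] by (simp add: inverse_eq_divide)
        ultimately have "\<bar>a r (\<tau> w) l\<bar> \<le> 0"
          using lim by (intro tendsto_le[OF sequentially_bot])
        then show ?thesis by simp
      qed
      then have "l \<in> stab actW w" using a(3)[OF \<tau>w] incl by blast
      then have "c p w l = 0" using c(3)[OF w] by blast
      moreover have "(\<lambda>m. \<bar>c p w ((s \<circ> \<sigma>) m)\<bar>) \<longlonglongrightarrow> \<bar>c p w l\<bar>"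
        by (intro tendsto_rabs continuous_on_tendsto_compose[OF c(2)[OF w] \<sigma>(2)]) auto
      then have "1 / real (Suc n) \<le> \<bar>c p w l\<bar>"
        by (rule LIMSEQ_le_const) (use s(3) in auto)
      ultimately show False by simp
    qed
    show "stab actZ (\<tau> w) \<subseteq> stab actW w" if Sw: "S w"
    proof
      fix g assume "g \<in> stab actZ (\<tau> w)"
      then have ag: "a r (\<tau> w) g = 0" for r using a(3)[OF \<tau>w] by blast
      obtain U where U: "U \<in> B" "g \<in> U"
        by (rule topological_basisE[OF B(2), of UNIV g]) auto
      have "\<bar>c p w g\<bar> \<le> 1 / real (Suc n)" for p n
      proof (rule ccontr)
        assume far: "\<not> \<bar>c p w g\<bar> \<le> 1 / real (Suc n)"
        obtain q where q: "\<And>g. g \<in> D \<Longrightarrow> g \<in> U \<Longrightarrow> near q w g \<Longrightarrow> \<bar>c p w g\<bar> \<le> 1 / real (Suc n)"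
          using Sw U(1) unfolding S_def by blast
        define X where "X = U \<inter> (\<Inter>r\<in>{..q}. {g. \<bar>a r (\<tau> w) g\<bar> < 1 / real (Suc q)})
          \<inter> {g. 1 / real (Suc n) < \<bar>c p w g\<bar>}"
        have "open X"
          unfolding X_def using topological_basis_open[OF B(2) U(1)] a(2)[OF \<tau>w] c(2)[OF w]
          by (intro open_Int open_INT ballI open_Collect_less continuous_intros) auto
        moreover have "g \<in> X" using U(2) ag far by (auto simp: X_def)
        ultimately obtain d where "d \<in> D" "d \<in> X" using D(2) by blast
        then show False using q[of d] by (auto simp: X_def near_def)
      qed
      then have "\<bar>c p w g\<bar> \<le> 0" for p
        using LIMSEQ_le_const[OF LIMSEQ_Suc[OF lim_inverse_n], of "\<bar>c p w g\<bar>"]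
        by (simp add: inverse_eq_divide)
      then have "\<forall>p. c p w g = 0" by simp
      then show "g \<in> stab actW w" using c(3)[OF w] by blast
    qed
  qed
  then have "{w\<in>space W. stab actZ (\<tau> w) \<subseteq> stab actW w} = {w\<in>space W. S w}" by blast
  also have "\<dots> \<in> sets W"
  proof -
    have [measurable]: "(\<lambda>w. c p w g) \<in> borel_measurable W" for p g by (rule c(1))
    have [measurable]: "(\<lambda>w. a p (\<tau> w) g) \<in> borel_measurable W" for p g
      by (rule measurable_compose[OF \<tau> a(1)])
    show ?thesis
      unfolding S_def near_def using B(1) D(1) by measurable
  qed
  finally show ?thesis .
qed

section \<open>The map between the quotient spaces\<close>

text \<open>
  Stabilizers are equivariant wherever \<open>\<psi>\<close> is, so \<open>\<phi>\<close> inherits this from \<open>stab (\<psi> x) = \<phi> x\<close>, for almost every \<open>k\<close>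
  simultaneously.
\<close>

lemma (in right_quasi_invariant_prob) stab_subgroup_map_equivariant:
  fixes actX :: "'g \<Rightarrow> 'x \<Rightarrow> 'x" and actZ :: "'g \<Rightarrow> 'z \<Rightarrow> 'z"
  assumes X: "G_space actX M" and Z: "G_space actZ Z" and \<psi>: "G_map actX M actZ Z \<psi>"
    and st: "AE x in M. stab actZ (\<psi> x) = \<phi> x"
  shows "AE x in M. AE k in m. \<forall>g\<in>\<phi> x. k + g - k \<in> \<phi> (actX k x)"
  using AE_space st G_space_AE_translates[OF X st] G_map_AE_equivariant[OF X Z \<psi>]
proof eventually_elim
  case (elim x)
  have \<psi>x: "\<psi> x \<in> space Z" using measurable_space[OF G_mapD(1)[OF \<psi>] elim(1)] .
  show ?case
    using elim(3,4)
  proof eventually_elim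
    case k: (elim k)
    show ?case
    proof
      fix g assume "g \<in> \<phi> x"
      then have g: "actZ g (\<psi> x) = \<psi> x" using elim(2) by (auto simp: stab_def)
      have "actZ (k + g - k) (actZ k (\<psi> x)) = actZ (k + g) (\<psi> x)"
        using G_spaceD(6)[OF Z \<psi>x, of "k + g - k" k] by simp
      also have "\<dots> = actZ k (\<psi> x)"
        using G_spaceD(6)[OF Z \<psi>x, of k g] g by simp
      finally have "k + g - k \<in> stab actZ (\<psi> (actX k x))"
        using k(2) by (simp add: stab_def)
      then show "k + g - k \<in> \<phi> (actX k x)" using k(1) by simp
    qed
  qed
qed

lemma Linf_comp_G_map:
  assumes p: "G_map actY N actX M p" and F: "F \<in> Linf M"
  shows "F \<circ> p \<in> Linf N"
proof -
  obtain C where "AE x in M. \<bar>F x\<bar> \<le> C" using F by (auto simp: Linf_def)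
  from G_map_AE[OF p this] have "AE y in N. \<bar>(F \<circ> p) y\<bar> \<le> C" by simp
  moreover have "F \<circ> p \<in> borel_measurable N"
    using F G_mapD(1)[OF p] by (auto simp: Linf_def intro: measurable_comp)
  ultimately show ?thesis by (auto simp: Linf_def)
qed

text \<open>
  The set of points at which \<open>\<tau>\<close> is equivariant under a given \<open>g\<close> is measurable, as \<open>Z\<close> has a measurable diagonal;
  so its preimage under \<open>\<xi>\<close> decides whether it is conull.
\<close>

lemma G_map_of_factor:
  assumes Y: "G_space actY N" and W: "G_space actW W" and Z: "G_space actZ Z"
    and \<xi>: "G_map actY N actW W \<xi>" and \<theta>: "G_map actY N actZ Z \<theta>"
    and \<tau>: "\<tau> \<in> W \<rightarrow>\<^sub>M Z" "AE y in N. \<tau> (\<xi> y) = \<theta> y"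
  shows "G_map actW W actZ Z \<tau>"
  unfolding G_map_def
proof (intro conjI allI)
  note [measurable] = \<tau>(1) G_mapD(1)[OF \<xi>] G_mapD(1)[OF \<theta>]
  show "\<tau> \<in> W \<rightarrow>\<^sub>M Z" by fact
  have "distr W Z \<tau> = distr (distr N W \<xi>) Z \<tau>" using G_mapD(2)[OF \<xi>] by simp
  also have "\<dots> = distr N Z (\<lambda>y. \<tau> (\<xi> y))" by (subst distr_distr) (auto simp: comp_def)
  also have "\<dots> = distr N Z \<theta>" using \<tau>(2) by (intro distr_cong_AE) auto
  also have "\<dots> = Z" by (rule G_mapD(2)[OF \<theta>])
  finally show "distr W Z \<tau> = Z" .
  fix g
  have actW: "(\<lambda>w. actW g w) \<in> W \<rightarrow>\<^sub>M W"
    by (rule G_space_measurable_act[OF W]) auto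
  have m1: "(\<lambda>w. \<tau> (actW g w)) \<in> W \<rightarrow>\<^sub>M Z" by (rule measurable_compose[OF actW \<tau>(1)])
  have m2: "(\<lambda>w. actZ g (\<tau> w)) \<in> W \<rightarrow>\<^sub>M Z"
    by (rule G_space_measurable_act[OF Z]) auto
  have "AE y in N. \<tau> (actW g (\<xi> y)) = actZ g (\<tau> (\<xi> y))"
    using \<tau>(2) G_space_AE_act[OF Y \<tau>(2), of g] G_mapD(3)[OF \<xi>, of g] G_mapD(3)[OF \<theta>, of g]
    by eventually_elim simp
  then have "AE w in distr N W \<xi>. \<tau> (actW g w) = actZ g (\<tau> w)"
    using standard_borel_equality_set[OF G_spaceD(2)[OF Z] m1 m2]
    by (subst AE_distr_iff) auto
  then show "AE w in W. \<tau> (actW g w) = actZ g (\<tau> w)" unfolding G_mapD(2)[OF \<xi>] .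
qed

lemma G_map_comp:
  assumes Y: "G_space actY N" and p: "G_map actY N actX M p" and q: "G_map actX M actZ Z q"
  shows "G_map actY N actZ Z (q \<circ> p)"
  unfolding G_map_def
proof (intro conjI allI)
  show "q \<circ> p \<in> N \<rightarrow>\<^sub>M Z" using G_mapD(1)[OF p] G_mapD(1)[OF q] by (rule measurable_comp)
  show "distr N Z (q \<circ> p) = Z"
    using distr_distr[OF G_mapD(1)[OF q] G_mapD(1)[OF p]] G_mapD(2)[OF p] G_mapD(2)[OF q] by simp
  show "AE y in N. (q \<circ> p) (actY g y) = actZ g ((q \<circ> p) y)" for g
    using G_mapD(3)[OF p, of g] G_map_AE[OF p G_mapD(3)[OF q, of g]] by eventually_elim simp
qed

theorem theorem4p11:
  fixes actX :: "'g::{topological_group_add, t2_space, second_countable_topology} \<Rightarrow> 'x \<Rightarrow> 'x"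
    and actY :: "'g \<Rightarrow> 'y \<Rightarrow> 'y"
    and actZ :: "'g \<Rightarrow> 'z \<Rightarrow> 'z"
    and actW :: "'g \<Rightarrow> 'w \<Rightarrow> 'w"
    and \<nu> :: "'x measure" and \<eta> :: "'y measure" and \<zeta> :: "'z measure" and \<rho> :: "'w measure"
    and \<pi> :: "'y \<Rightarrow> 'x" and \<phi> :: "'x \<Rightarrow> 'g set"
    and \<psi> :: "'x \<Rightarrow> 'z" and \<xi> :: "'y \<Rightarrow> 'w"
  assumes "locally_compact_space (euclidean :: 'g topology)"
    and "G_space actX \<nu>" and "G_space actY \<eta>"
    and "G_map actY \<eta> actX \<nu> \<pi>"
    and "equivariant_subgroup_map actX \<nu> \<phi>"
    and "AE x in \<nu>. stab actX x \<subseteq> \<phi> x"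
    and "quotient_space_over actX \<nu> \<phi> actZ \<zeta> \<psi>"
    and "quotient_space_over actY \<eta> (\<phi> \<circ> \<pi>) actW \<rho> \<xi>"
  shows "\<exists>\<tau>. G_map actW \<rho> actZ \<zeta> \<tau> \<and>
              (AE y in \<eta>. \<tau> (\<xi> y) = \<psi> (\<pi> y)) \<and>
              (orbital_G_map actY \<eta> actX \<nu> \<pi> \<and> (AE x in \<nu>. stab actZ (\<psi> x) = \<phi> x) \<longrightarrow>
                 orbital_G_map actW \<rho> actZ \<zeta> \<tau> \<and>
                 (AE y in \<eta>. stab actW (\<xi> y) = \<phi> (\<pi> y)))"
proof -
  note X = assms(2) and Y = assms(3) and \<pi> = assms(4)
  have Z: "G_space actZ \<zeta>" and \<psi>: "G_map actX \<nu> actZ \<zeta> \<psi>"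
    and algX: "invariant_algebra actX \<nu> \<phi> = pullback_algebra \<nu> \<zeta> \<psi>"
    using assms(7) by (auto simp: quotient_space_over_def)
  have W: "G_space actW \<rho>" and \<xi>: "G_map actY \<eta> actW \<rho> \<xi>"
    and algY: "invariant_algebra actY \<eta> (\<phi> \<circ> \<pi>) = pullback_algebra \<eta> \<rho> \<xi>"
    using assms(8) by (auto simp: quotient_space_over_def)
  obtain \<mu> :: "'g measure" where "right_haar \<mu>" using right_haar_exists[OF assms(1)] by blast
  with assms(1) interpret \<mu>: right_haar_group \<mu> by unfold_locales
  obtain m :: "'g measure" where m: "prob_space m" "sets m = sets borel"
      "\<And>P. (AE k in m. P k) \<longleftrightarrow> (AE k in \<mu>. P k)"
    by (rule \<mu>.equivalent_prob_measure) blast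
  interpret m: prob_space m by (rule m(1))
  interpret m: right_quasi_invariant_prob m
    by unfold_locales (use m(2) \<mu>.haar_AE_shift in \<open>auto simp: m(3)\<close>)
  have \<theta>: "G_map actY \<eta> actZ \<zeta> (\<psi> \<circ> \<pi>)" by (rule G_map_comp[OF Y \<pi> \<psi>])
  have factor: "\<exists>E\<in>Linf \<rho>. AE y in \<eta>. F ((\<psi> \<circ> \<pi>) y) = E (\<xi> y)" if F: "F \<in> Linf \<zeta>" for F
  proof -
    have "F \<circ> \<psi> \<in> pullback_algebra \<nu> \<zeta> \<psi>"
      using Linf_comp_G_map[OF \<psi> F] F unfolding pullback_algebra_def by auto
    then have "(F \<circ> \<psi>) \<circ> \<pi> \<in> pullback_algebra \<eta> \<rho> \<xi>"
      using m.invariant_algebra_comp[OF Y X \<pi>, of "F \<circ> \<psi>" \<phi>] by (simp add: algX algY)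
    then show ?thesis by (auto simp: pullback_algebra_def)
  qed
  obtain \<tau> where \<tau>: "\<tau> \<in> \<rho> \<rightarrow>\<^sub>M \<zeta>" "AE y in \<eta>. \<tau> (\<xi> y) = (\<psi> \<circ> \<pi>) y"
    by (rule factor_map_of_Linf[OF G_spaceD(2,3)[OF Z] G_mapD(1)[OF \<xi>] G_mapD(1)[OF \<theta>] factor])
  have \<tau>_map: "G_map actW \<rho> actZ \<zeta> \<tau>" by (rule G_map_of_factor[OF Y W Z \<xi> \<theta> \<tau>])
  have "orbital_G_map actW \<rho> actZ \<zeta> \<tau> \<and> (AE y in \<eta>. stab actW (\<xi> y) = \<phi> (\<pi> y))"
    if st: "AE x in \<nu>. stab actZ (\<psi> x) = \<phi> x"
  proof -
    have "AE y in \<eta>. AE k in m. \<forall>g\<in>(\<phi> \<circ> \<pi>) y. k + g - k \<in> (\<phi> \<circ> \<pi>) (actY k y)"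
      using G_map_AE[OF \<pi> m.stab_subgroup_map_equivariant[OF X Z \<psi> st]]
        m.G_map_AE_equivariant[OF Y X \<pi>]
    proof eventually_elim
      case (elim y)
      from elim(1,2) show ?case by eventually_elim simp
    qed
    from m.quotient_space_over_subset_stab[OF Y assms(8) this]
    have ge: "AE y in \<eta>. \<phi> (\<pi> y) \<subseteq> stab actW (\<xi> y)" by simp
    have le: "AE w in \<rho>. stab actW w \<subseteq> stab actZ (\<tau> w)"
      by (rule m.G_map_stab_subset[OF W Z \<tau>_map])
    have eq: "AE y in \<eta>. stab actW (\<xi> y) = \<phi> (\<pi> y) \<and> stab actZ (\<tau> (\<xi> y)) = \<phi> (\<pi> y)"
      using ge G_map_AE[OF \<xi> le] \<tau>(2) G_map_AE[OF \<pi> st] by eventually_elim auto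
    \<comment> \<open>Only this inclusion has to be transported from \<open>Y\<close> to \<open>W\<close>; the other one holds on \<open>W\<close> already.\<close>
    have "AE y in \<eta>. stab actZ (\<tau> (\<xi> y)) \<subseteq> stab actW (\<xi> y)"
      using eq by eventually_elim simp
    then have "AE w in distr \<eta> \<rho> \<xi>. stab actZ (\<tau> w) \<subseteq> stab actW w"
      using \<mu>.stab_subset_stab_measurable[OF W Z \<tau>(1)] G_mapD(1)[OF \<xi>]
      by (subst AE_distr_iff) auto
    then have "AE w in \<rho>. stab actZ (\<tau> w) \<subseteq> stab actW w" unfolding G_mapD(2)[OF \<xi>] .
    with le have "AE w in \<rho>. stab actW w = stab actZ (\<tau> w)" by eventually_elim auto
    with \<tau>_map eq show ?thesis unfolding orbital_G_map_def by auto
  qed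
  with \<tau>_map \<tau>(2) show ?thesis by auto
qed

end
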